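(* For an integer $\ell$ such that $12\ell+4\delta+6\varepsilon \in 2\mathbb{Z}_{\ge1} \setminus \{4\}$, we have \begin{align*} &\sum_{n=0}^{\infty} \omega_{k,n}(\ell)\, p^{n-m} = \frac{E_{4}(p)^{2-2\delta} E_{6}(p)^{1-2\varepsilon}}{\Delta(p)^{\ell+m+1}}\, G_{12\ell+4\delta+6\varepsilon}(p) \quad (\text{weight } 2-k),\\ &\sum_{n=0}^{\infty} \Omega_{2-k,n}(\ell)\, p^{n+m+1} = \Delta(p)^{m-\ell}\, G_{12\ell+4\delta+6\varepsilon}(p) \quad (\text{weight } k). \end{align*} In particular, $G_{12\ell+4\delta+6\varepsilon}(p)=\sum_{n=0}^{\infty} \Omega_{2-(12\ell+4\delta+6\varepsilon),n}(\ell)\, p^{n+\ell+1}$.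
   Context: Let $q=e^{2\pi i\tau}$, $p=e^{2\pi i\sigma}$, $E_2,E_4,E_6$ the normalized Eisenstein series on $SL_2(\mathbb{Z})$, $\Delta=(E_4^3-E_6^2)/1728$, $j=E_4^3/\Delta$. $G_w$ denotes the normalized extremal quasimodular form of weight $w$ and depth $1$ on $SL_2(\mathbb{Z})$, i.e. the unique quasimodular form of weight $w$ and depth exactly $1$ of the form $q^{d-1}(1+O(q))$ with $d$ the dimension of the space of quasimodular forms of weight $w$ and depth $\le 1$; $G_{6n+4}=E_4G_{6n}$. The Atkin-like polynomials $A_{m,r}(X)$ ($r\in\{0,2,6,8\}$) are the monic polynomials (together with monic $B_{m,r}$) in Kaneko–Koike's expressions $G_{12m} = N_{m,0}^{-1}( - E_{2} E_{4} E_{6} \Delta^{m-1} A_{m,0}(j) + \Delta^{m} B_{m,0}(j))$, $G_{12m+2} = N_{m,2}^{-1}( E_{2} \Delta^{m} A_{m,2}(j) - E_{4}^{2} E_{6} \Delta^{m-1} B_{m,2}(j))$, $G_{12m+6} = N_{m,6}^{-1}( E_{2} E_{4} \Delta^{m} A_{m,6}(j) - E_{6} \Delta^{m} B_{m,6}(j))$, $G_{12m+8} = N_{m,8}^{-1}( - E_{2} E_{6} \Delta^{m} A_{m,8}(j) + E_{4}^{2} \Delta^{m} B_{m,8}(j))$, with $N_{m,0}=24m\binom{6m}{2m}\binom{12m}{6m}$, $N_{m,2}=\frac{12m+1}{12m-1}N_{m,0}$, $N_{m,6}=N_{m+1/2,0}$, $N_{m,8}=N_{m+1/2,2}$ ($N_{0,0}=N_{0,2}=1$);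 $A_{m,2}$ is the Atkin polynomial. Set also $A_{m,4}:=A_{m,0}$, $A_{m,10}:=A_{m,6}$, $A_{m,14}:=A_{m+1,2}$. Write the even integer $k=12m+4\delta+6\varepsilon$ with $m\in\mathbb{Z}$, $\delta\in\{0,1,2\}$, $\varepsilon\in\{0,1\}$. The generalized Faber polynomial $F_{k,n}(X)$ is the monic degree-$n$ polynomial such that, for $\ell\ge -m$, $f_{k,\ell}=E_4^{\delta}E_6^{\varepsilon}\Delta^{m}F_{k,\ell+m}(j)$ is the unique weakly holomorphic modular form of weight $k$ with $f_{k,\ell}=q^{-\ell}+O(q^{m+1})$ (and similarly for weight $2-k$). Define $\omega_{k,n}(r)$ and $\Omega_{2-k,n}(r)$ by the expansions $F_{k,n}(X)=\sum_r \omega_{k,n}(r)A_{r,4\delta+6\varepsilon}(X)$ and $F_{2-k,n}(X)=\sum_r \Omega_{2-k,n}(r)A_{r,4\delta+6\varepsilon}(X)$, where $r$ runs over integers with $0\le \deg A_{r,4\delta+6\varepsilon}\le n$. *)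

theory Defs
  imports Complex_Main
    "HOL-Computational_Algebra.Formal_Laurent_Series"
begin

text \<open>
  Forms are represented by their expansions at the cusp, i.e. as formal Laurent series over the
  complex numbers in one variable (written \<open>q\<close> or \<open>p\<close>).
\<close>

definition sigma_pow :: "nat \<Rightarrow> nat \<Rightarrow> nat" where
  "sigma_pow s n = (\<Sum>d | d dvd n. d ^ s)"

definition eisenstein :: "complex \<Rightarrow> nat \<Rightarrow> complex fls" where
  "eisenstein c s =
     fps_to_fls (Abs_fps (\<lambda>n. if n = 0 then 1 else c * of_nat (sigma_pow s n)))"

definition E2 :: "complex fls" where "E2 = eisenstein (- 24) 1"
definition E4 :: "complex fls" where "E4 = eisenstein 240 3"
definition E6 :: "complex fls" where "E6 = eisenstein (- 504) 5"

definition Delta :: "complex fls" where "Delta = (E4 ^ 3 - E6 ^ 2) / 1728"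

definition klein_j :: "complex fls" where "klein_j = E4 ^ 3 / Delta"

definition at_j :: "complex poly \<Rightarrow> complex fls" where
  "at_j P = poly (map_poly fls_const P) klein_j"

global_interpretation fls_vs: vector_space "\<lambda>(c::complex) f. fls_const c * f"
  by unfold_locales (simp_all add: algebra_simps flip: fls_const_mult_const fls_plus_const)

text \<open>
  Quasimodular forms of weight \<open>w\<close> on \<open>SL\<^sub>2(\<int>)\<close> are the isobaric elements of weight \<open>w\<close> of the
  graded ring \<open>\<complex>[E\<^sub>2, E\<^sub>4, E\<^sub>6]\<close>, and the depth is the degree in \<open>E\<^sub>2\<close>.  The following is the space
  of those of weight \<open>w\<close> and depth at most \<open>s\<close>; for \<open>s = 0\<close> it is the space of modular forms
  of weight \<open>w\<close>.
\<close>

definition quasimodular :: "int \<Rightarrow> nat \<Rightarrow> complex fls set" where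
  "quasimodular w s =
     fls_vs.span {E2 ^ a * E4 ^ b * E6 ^ c | a b c.
       a \<le> s \<and> 2 * int a + 4 * int b + 6 * int c = w}"

definition mero_quasimodular :: "int \<Rightarrow> complex fls set" where
  "mero_quasimodular v =
     {f / g | f g w u s. f \<in> quasimodular w s \<and> g \<in> quasimodular u 0 \<and> g \<noteq> 0 \<and> w - u = v}"

definition normalized_extremal :: "int \<Rightarrow> complex fls \<Rightarrow> bool" where
  "normalized_extremal w f \<longleftrightarrow>
     f \<in> quasimodular w 1 \<and> f \<notin> quasimodular w 0 \<and>
     (let d = int (fls_vs.dim (quasimodular w 1))
      in fls_nth f (d - 1) = 1 \<and> (\<forall>i < d - 1. fls_nth f i = 0))"

text \<open>The weights in which there are quasimodular forms of depth exactly 1.\<close>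

definition depth1_weight :: "int \<Rightarrow> bool" where
  "depth1_weight w \<longleftrightarrow> even w \<and> w \<ge> 2 \<and> w \<noteq> 4"

definition extremal_family :: "(int \<Rightarrow> complex fls) \<Rightarrow> bool" where
  "extremal_family G \<longleftrightarrow> (\<forall>w. depth1_weight w \<longrightarrow> normalized_extremal w (G w))"

text \<open>
  The normalizing constants of Kaneko and Koike are taken at integers and half-integers, so they
  are indexed by \<open>M = 2m\<close>: \<open>norm0 (2m) = N\<^bsub>m,0\<^esub>\<close>, \<open>norm0 (2m+1) = N\<^bsub>m,6\<^esub>\<close>,
  \<open>norm2 (2m) = N\<^bsub>m,2\<^esub>\<close> and \<open>norm2 (2m+1) = N\<^bsub>m,8\<^esub>\<close>.
\<close>

definition norm0 :: "nat \<Rightarrow> complex" where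
  "norm0 M = (if M = 0 then 1
     else 12 * of_nat M * of_nat ((3 * M) choose M) * of_nat ((6 * M) choose (3 * M)))"

definition norm2 :: "nat \<Rightarrow> complex" where
  "norm2 M = (if M = 0 then 1
     else (6 * of_nat M + 1) / (6 * of_nat M - 1) * norm0 M)"

text \<open>
  \<open>A m r\<close> and \<open>B m r\<close> are the monic polynomials in the expressions of Kaneko and Koike.  For
  \<open>r = 0\<close> these start at \<open>m = 1\<close>, as there is no form of weight 0 and depth 1.  In the degenerate
  case \<open>G\<^sub>2 = E\<^sub>2\<close> one has \<open>A = 1\<close> and \<open>B = 0\<close>, which is not monic.
\<close>

definition atkin_like ::
    "(int \<Rightarrow> complex fls) \<Rightarrow> (int \<Rightarrow> nat \<Rightarrow> complex poly) \<Rightarrow> (int \<Rightarrow> nat \<Rightarrow> complex poly) \<Rightarrow> bool"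
where
  "atkin_like G A B \<longleftrightarrow>
     (\<forall>m \<ge> 1.
        lead_coeff (A m 0) = 1 \<and> lead_coeff (B m 0) = 1 \<and>
        G (12 * m) = fls_const (inverse (norm0 (nat (2 * m)))) *
          (- E2 * E4 * E6 * Delta powi (m - 1) * at_j (A m 0)
           + Delta powi m * at_j (B m 0))) \<and>
     (\<forall>m \<ge> 0.
        lead_coeff (A m 2) = 1 \<and> (if m = 0 then B m 2 = 0 else lead_coeff (B m 2) = 1) \<and>
        G (12 * m + 2) = fls_const (inverse (norm2 (nat (2 * m)))) *
          (E2 * Delta powi m * at_j (A m 2)
           - E4 ^ 2 * E6 * Delta powi (m - 1) * at_j (B m 2))) \<and>
     (\<forall>m \<ge> 0.
        lead_coeff (A m 6) = 1 \<and> lead_coeff (B m 6) = 1 \<and>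
        G (12 * m + 6) = fls_const (inverse (norm0 (nat (2 * m + 1)))) *
          (E2 * E4 * Delta powi m * at_j (A m 6)
           - E6 * Delta powi m * at_j (B m 6))) \<and>
     (\<forall>m \<ge> 0.
        lead_coeff (A m 8) = 1 \<and> lead_coeff (B m 8) = 1 \<and>
        G (12 * m + 8) = fls_const (inverse (norm2 (nat (2 * m + 1)))) *
          (- E2 * E6 * Delta powi m * at_j (A m 8)
           + E4 ^ 2 * Delta powi m * at_j (B m 8)))"

definition atkin_ext :: "(int \<Rightarrow> nat \<Rightarrow> complex poly) \<Rightarrow> int \<Rightarrow> nat \<Rightarrow> complex poly" where
  "atkin_ext A r t =
     (if t = 4 then A r 0 else if t = 10 then A r 6 else if t = 14 then A (r + 1) 2 else A r t)"

text \<open>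
  The range of summation \<open>0 \<le> deg A\<^bsub>r,t\<^esub> \<le> n\<close>.  The first condition singles out the \<open>r\<close> for which
  \<open>A\<^bsub>r,t\<^esub>\<close> is a (nonzero) polynomial: \<open>r \<ge> 1\<close> for \<open>t = 0, 4\<close>, \<open>r \<ge> 0\<close> for \<open>t = 6, 8, 10\<close>, and
  \<open>r \<ge> -1\<close> for \<open>t = 14\<close>.
\<close>

definition atkin_range :: "(int \<Rightarrow> nat \<Rightarrow> complex poly) \<Rightarrow> nat \<Rightarrow> nat \<Rightarrow> int set" where
  "atkin_range A t n = {r. depth1_weight (12 * r + int t) \<and> degree (atkin_ext A r t) \<le> n}"

text \<open>The weight \<open>k = 12m + 4\<delta> + 6\<epsilon>\<close> determines \<open>m\<close>, \<open>\<delta>\<close> and \<open>\<epsilon>\<close>.\<close>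

definition weight_decomp :: "int \<Rightarrow> int \<Rightarrow> nat \<Rightarrow> nat \<Rightarrow> bool" where
  "weight_decomp k m \<delta> \<epsilon> \<longleftrightarrow>
     \<delta> \<in> {0, 1, 2} \<and> \<epsilon> \<in> {0, 1} \<and> k = 12 * m + 4 * int \<delta> + 6 * int \<epsilon>"

text \<open>
  \<open>F k n\<close> is the generalized Faber polynomial \<open>F\<^bsub>k,n\<^esub>\<close>; with \<open>l = n - m\<close>, the form
  \<open>f\<^bsub>k,l\<^esub> = E\<^sub>4\<^sup>\<delta> E\<^sub>6\<^sup>\<epsilon> \<Delta>\<^sup>m F\<^bsub>k,l+m\<^esub>(j)\<close> equals \<open>q\<^bsup>-l\<^esup> + O(q\<^bsup>m+1\<^esup>)\<close>.  It has weight \<open>k\<close> and is weakly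
  holomorphic by its shape.
\<close>

definition faber_family :: "(int \<Rightarrow> nat \<Rightarrow> complex poly) \<Rightarrow> bool" where
  "faber_family F \<longleftrightarrow>
     (\<forall>k m \<delta> \<epsilon> n. weight_decomp k m \<delta> \<epsilon> \<longrightarrow>
        lead_coeff (F k n) = 1 \<and> degree (F k n) = n \<and>
        (let f = E4 ^ \<delta> * E6 ^ \<epsilon> * Delta powi m * at_j (F k n); l = int n - m
         in \<forall>i \<le> m. fls_nth f i = (if i = - l then 1 else 0)))"

text \<open>
  The coefficients of \<open>F\<^bsub>k,n\<^esub>\<close> and of \<open>F\<^bsub>2-k,n\<^esub>\<close> with respect to the \<open>A\<^bsub>r,4\<delta>+6\<epsilon>\<^esub>\<close>, where in both cases
  \<open>\<delta>\<close> and \<open>\<epsilon>\<close> belong to \<open>k\<close>.  The coefficients of those \<open>A\<^bsub>r,4\<delta>+6\<epsilon>\<^esub>\<close> that do not occur are zero.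
\<close>

definition faber_coeffs ::
    "(int \<Rightarrow> nat \<Rightarrow> complex poly) \<Rightarrow> (int \<Rightarrow> nat \<Rightarrow> complex poly) \<Rightarrow> (int \<Rightarrow> nat \<Rightarrow> int \<Rightarrow> complex) \<Rightarrow> bool"
where
  "faber_coeffs A F \<omega> \<longleftrightarrow>
     (\<forall>k m \<delta> \<epsilon> n. weight_decomp k m \<delta> \<epsilon> \<longrightarrow>
        (let t = 4 * \<delta> + 6 * \<epsilon>
         in F k n = (\<Sum>r \<in> atkin_range A t n. smult (\<omega> k n r) (atkin_ext A r t)) \<and>
            (\<forall>r. r \<notin> atkin_range A t n \<longrightarrow> \<omega> k n r = 0)))"

definition dual_faber_coeffs ::
    "(int \<Rightarrow> nat \<Rightarrow> complex poly) \<Rightarrow> (int \<Rightarrow> nat \<Rightarrow> complex poly) \<Rightarrow> (int \<Rightarrow> nat \<Rightarrow> int \<Rightarrow> complex) \<Rightarrow> bool"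
where
  "dual_faber_coeffs A F \<Omega> \<longleftrightarrow>
     (\<forall>k m \<delta> \<epsilon> n. weight_decomp k m \<delta> \<epsilon> \<longrightarrow>
        (let t = 4 * \<delta> + 6 * \<epsilon>
         in F (2 - k) n = (\<Sum>r \<in> atkin_range A t n. smult (\<Omega> (2 - k) n r) (atkin_ext A r t)) \<and>
            (\<forall>r. r \<notin> atkin_range A t n \<longrightarrow> \<Omega> (2 - k) n r = 0)))"

end

theory Submission
  imports Defs
    "HOL-Computational_Algebra.Polynomial_Factorial"
    "HOL-Computational_Algebra.Field_as_Ring"
begin

text \<open>
  By Ramanujan's differential equations (obtained from an elementary double counting of
  the solutions of \<open>a x + b y = n\<close>), \<open>q dj/dq = - E\<^sub>4\<^sup>2 E\<^sub>6 / \<Delta>\<close>, and \<open>E\<^sub>2\<close> is not a rational function of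
  \<open>E\<^sub>4\<close> and \<open>E\<^sub>6\<close>: it would give a rational solution of a Riccati equation in \<open>j\<close>, and the
  possible local behaviours of one at \<open>0\<close>, \<open>1728\<close> and \<open>\<infinity>\<close> are incompatible.  Hence \<open>G\<^sub>w\<close> divided by \<open>E\<^sub>4\<^sup>\<delta> E\<^sub>6\<^sup>\<epsilon> \<Delta>\<^sup>l\<close> is the error \<open>A(j) \<phi> - B(j)\<close> of a
  Pade approximation in \<open>1 / j\<close> of a fixed quotient \<open>\<phi>\<close>, so that the Atkin-like polynomials are
  orthogonal with respect to the residue of \<open>P(j) \<phi> dj\<close>, with these errors as (normalized) functions
  of the second kind.  The coefficient of \<open>A\<^sub>l\<close> in a Faber polynomial is therefore a residue, which the
  expansion \<open>q\<^bsup>-n\<^esup> + O(q\<^bsup>m+1\<^esup>)\<close> of the corresponding form identifies with a coefficient of \<open>G\<^sub>w\<close> times the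
  stated factor.
\<close>

section \<open>Convolution sums of divisor functions\<close>

text \<open>Forms are known here only as formal series, so neither transformation laws nor a valence
  formula can supply identities, dimensions or independence. The differential equations therefore
  rest on counting, and the irrationality of \<open>E2\<close> on algebra in \<open>klein_j\<close>.
  Irrationality makes the two polynomials in p(j) \<phi> + q(j) unique. This gives the dimension of
  the space of depth at most one, through which the order of G_w is prescribed, and it lets the
  given presentation of G_w be compared with the general shape of such forms, which bounds the
  degree of A. Only that bound is available at first, since monicity says nothing about the degree.
  Equality comes from the Faber polynomials, which exist in every degree and expand in the A. The
  factors in the theorem come from one product: the cores E4^\<delta> E6^\<epsilon> \<Delta>^m
  belonging to the weights k and 2 - k multiply to E4^2 E6 / \<Delta>, which is minus the derivative
  of j. Dividing this derivative by one core leaves the other.\<close>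

definition weighted_reps :: "nat \<Rightarrow> (nat \<times> nat \<times> nat \<times> nat) set" where
  "weighted_reps n = {(a, b, x, y). a > 0 \<and> b > 0 \<and> x > 0 \<and> y > 0 \<and> a * x + b * y = n}"

lemma finite_weighted_reps [simp]: "finite (weighted_reps n)"
proof (rule finite_subset)
  show "weighted_reps n \<subseteq> {..n} \<times> {..n} \<times> {..n} \<times> {..n}"
  proof clarsimp
    fix a b x y assume "(a, b, x, y) \<in> weighted_reps n"
    hence *: "a > 0" "b > 0" "x > 0" "y > 0" "a * x + b * y = n"
      by (auto simp: weighted_reps_def)
    have "a \<le> a * x" "x \<le> a * x" "b \<le> b * y" "y \<le> b * y"
      using * by auto
    thus "a \<le> n \<and> b \<le> n \<and> x \<le> n \<and> y \<le> n"
      using * by linarith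
  qed
qed auto

definition rep_sum :: "nat \<Rightarrow> (nat \<Rightarrow> nat \<Rightarrow> complex) \<Rightarrow> complex" where
  "rep_sum n f = (\<Sum>(a, b, x, y) \<in> weighted_reps n. f a b)"

text \<open>A subtraction step on (x, y) is compensated by an addition in (a, b). This is one
  identity up to exchanging \<open>a\<close> and \<open>b\<close> and reordering, listed in four
  arrangements for rewriting.\<close>

lemma shear:
  assumes "x < (y :: nat)"
  shows "(a + b) * x + b * (y - x) = a * x + b * y"
    and "a * (y - x) + (a + b) * x = a * y + b * x"
    and "(y - x) * a + x * (a + b) = y * a + x * b"
    and "x * (a + b) + (y - x) * b = x * a + y * b"
proof -
  obtain k where "y = x + k" using assms less_imp_add_positive by blast
  thus "(a + b) * x + b * (y - x) = a * x + b * y"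
    and "a * (y - x) + (a + b) * x = a * y + b * x"
    and "(y - x) * a + x * (a + b) = y * a + x * b"
    and "x * (a + b) + (y - x) * b = x * a + y * b"
    by (simp_all add: algebra_simps)
qed

lemma sum_reps_x_less_y:
  assumes "\<And>a b. h (a + b) b = f a b"
  shows "(\<Sum>(a, b, x, y) \<in> {(a, b, x, y) \<in> weighted_reps n. x < y}. f a b) =
         (\<Sum>(a, b, x, y) \<in> {(a, b, x, y) \<in> weighted_reps n. a > b}. (h a b :: complex))"
  by (rule sum.reindex_bij_witness[where
        i = "\<lambda>(a, b, x, y). (a - b, b, x, x + y)" and j = "\<lambda>(a, b, x, y). (a + b, b, x, y - x)"])
   (clarsimp simp: weighted_reps_def assms shear; fail)+

lemma sum_reps_y_less_x:
  assumes "\<And>a b. h a (a + b) = f a b"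
  shows "(\<Sum>(a, b, x, y) \<in> {(a, b, x, y) \<in> weighted_reps n. y < x}. f a b) =
         (\<Sum>(a, b, x, y) \<in> {(a, b, x, y) \<in> weighted_reps n. a < b}. (h a b :: complex))"
  by (rule sum.reindex_bij_witness[where
        i = "\<lambda>(a, b, x, y). (a, b - a, x + y, y)" and j = "\<lambda>(a, b, x, y). (a, a + b, x - y, y)"])
   (clarsimp simp: weighted_reps_def assms shear; fail)+

lemma sum_trichotomy:
  fixes u v :: "'b \<Rightarrow> nat" and g :: "'b \<Rightarrow> 'c :: comm_monoid_add"
  assumes "finite S"
  shows "sum g S = sum g {s \<in> S. u s < v s} + sum g {s \<in> S. v s < u s} + sum g {s \<in> S. u s = v s}"
proof -
  have "S = ({s \<in> S. u s < v s} \<union> {s \<in> S. v s < u s}) \<union> {s \<in> S. u s = v s}"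
    by auto
  also have "sum g \<dots> = sum g ({s \<in> S. u s < v s} \<union> {s \<in> S. v s < u s}) + sum g {s \<in> S. u s = v s}"
    by (rule sum.union_disjoint) (use assms in auto)
  also have "sum g ({s \<in> S. u s < v s} \<union> {s \<in> S. v s < u s}) =
      sum g {s \<in> S. u s < v s} + sum g {s \<in> S. v s < u s}"
    by (rule sum.union_disjoint) (use assms in auto)
  finally show ?thesis .
qed

text \<open>Here (a + b) x = n, so \<open>d\<close> is the divisor a + b and x is its
  cofactor.\<close>

lemma rep_sum_diag_x:
  assumes "n > 0"
  shows "(\<Sum>(a, b, x, y) \<in> {(a, b, x, y) \<in> weighted_reps n. x = y}. f a b) =
         (\<Sum>d | d dvd n. \<Sum>a = 1..<d. (f a (d - a) :: complex))"
proof -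
  have *: "(a + b) dvd a * y + b * y" "(a * y + b * y) div (a + b) = y" if "a > 0" for a b y :: nat
    using that by (simp_all flip: distrib_right)
  have **: "a * (n div d) + (d - a) * (n div d) = n" if "d dvd n" "a < d" for a d
    using that by (simp flip: distrib_right)
  have pos: "0 < d" "0 < n div d" if "d dvd n" for d
    using that assms by (auto simp: dvd_div_eq_0_iff dvd_pos_nat)
  have fin: "finite {d. d dvd n}" using assms by simp
  have "(\<Sum>d | d dvd n. \<Sum>a = 1..<d. f a (d - a)) =
        (\<Sum>(d, a) \<in> (SIGMA d:{d. d dvd n}. {1..<d}). f a (d - a))"
    by (rule sum.Sigma) (use fin in auto)
  also have "\<dots> = (\<Sum>(a, b, x, y) \<in> {(a, b, x, y) \<in> weighted_reps n. x = y}. f a b)"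
    by (rule sum.reindex_bij_witness[where
        i = "\<lambda>(a, b, x, y). (a + b, a)" and j = "\<lambda>(d, a). (a, d - a, n div d, n div d)"])
      (auto simp: weighted_reps_def * ** pos; fail)+
  finally show ?thesis ..
qed

text \<open>Here a (x + y) = n, and the cofactor n div a splits into two positive parts in n div a -
  1 ways.\<close>

lemma rep_sum_diag_a:
  assumes "n > 0"
  shows "(\<Sum>(a, b, x, y) \<in> {(a, b, x, y) \<in> weighted_reps n. a = b}. f a b) =
         (\<Sum>d | d dvd n. (of_nat (n div d) - 1) * (f d d :: complex))"
proof -
  have *: "a dvd a * x + a * y" "(a * x + a * y) div a = x + y" if "a > 0" for a x y :: nat
    using that by (simp_all flip: distrib_left)
  have **: "d * x + d * (n div d - x) = n" if "d dvd n" "x < n div d" for x d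
    using that by (simp flip: distrib_left)
  have pos: "0 < d" "0 < n div d" if "d dvd n" for d
    using that assms by (auto simp: dvd_div_eq_0_iff dvd_pos_nat)
  have fin: "finite {d. d dvd n}" using assms by simp
  have "(\<Sum>d | d dvd n. (of_nat (n div d) - 1) * f d d) =
        (\<Sum>d | d dvd n. \<Sum>x = 1..<n div d. f d d)"
    by (intro sum.cong refl) (use assms in \<open>auto elim!: dvdE simp: of_nat_diff Suc_le_eq\<close>)
  also have "\<dots> = (\<Sum>(d, x) \<in> (SIGMA d:{d. d dvd n}. {1..<n div d}). f d d)"
    by (rule sum.Sigma) (use fin in auto)
  also have "\<dots> = (\<Sum>(a, b, x, y) \<in> {(a, b, x, y) \<in> weighted_reps n. a = b}. f a b)"
    by (rule sum.reindex_bij_witness[where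
        i = "\<lambda>(a, b, x, y). (a, x)" and j = "\<lambda>(d, x). (d, d, x, n div d - x)"])
      (auto simp: weighted_reps_def * ** pos; fail)+
  finally show ?thesis ..
qed

text \<open>
  Split the representations \<open>a x + b y = n\<close> by the sign of \<open>x - y\<close> and rewrite
  \<open>a x + b y = a (x - y) + (a + b) y\<close> for \<open>x > y\<close>, symmetrically for \<open>x < y\<close>.
  The two pieces reassemble to a sum of \<open>h\<close> over \<open>a \<noteq> b\<close>.
\<close>

lemma rep_sum_descent:
  assumes "n > 0" and "\<And>a b. h a (a + b) = f a b" and "\<And>a b. h (a + b) b = f a b"
  shows "rep_sum n (\<lambda>a b. f a b - h a b) =
     (\<Sum>d | d dvd n. \<Sum>a = 1..<d. f a (d - a)) - (\<Sum>d | d dvd n. (of_nat (n div d) - 1) * h d d)"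
proof -
  have "rep_sum n f = (\<Sum>(a, b, x, y) \<in> {(a, b, x, y) \<in> weighted_reps n. x < y}. f a b)
     + (\<Sum>(a, b, x, y) \<in> {(a, b, x, y) \<in> weighted_reps n. y < x}. f a b)
     + (\<Sum>(a, b, x, y) \<in> {(a, b, x, y) \<in> weighted_reps n. x = y}. f a b)"
    using sum_trichotomy[OF finite_weighted_reps, of "\<lambda>(a, b, x, y). f a b" n
        "\<lambda>(a, b, x, y). x" "\<lambda>(a, b, x, y). y"]
    by (simp add: rep_sum_def case_prod_unfold)
  moreover have "rep_sum n h = (\<Sum>(a, b, x, y) \<in> {(a, b, x, y) \<in> weighted_reps n. a < b}. h a b)
     + (\<Sum>(a, b, x, y) \<in> {(a, b, x, y) \<in> weighted_reps n. b < a}. h a b)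
     + (\<Sum>(a, b, x, y) \<in> {(a, b, x, y) \<in> weighted_reps n. a = b}. h a b)"
    using sum_trichotomy[OF finite_weighted_reps, of "\<lambda>(a, b, x, y). h a b" n
        "\<lambda>(a, b, x, y). a" "\<lambda>(a, b, x, y). b"]
    by (simp add: rep_sum_def case_prod_unfold)
  moreover have "rep_sum n (\<lambda>a b. f a b - h a b) = rep_sum n f - rep_sum n h"
    by (simp add: rep_sum_def case_prod_unfold sum_subtractf)
  ultimately show ?thesis
    using sum_reps_x_less_y[of h f n, OF assms(3)] sum_reps_y_less_x[of h f n, OF assms(2)]
      rep_sum_diag_x[OF assms(1), of f] rep_sum_diag_a[OF assms(1), of h]
    by simp
qed

section \<open>Products of the generating series of divisor sums\<close>

definition sigma_fps :: "nat \<Rightarrow> complex fps" where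
  "sigma_fps s = Abs_fps (\<lambda>n. of_nat (sigma_pow s n))"

text \<open>Every number divides 0, and the sum over this infinite set is 0 by convention. Hence the
  end terms of the convolutions vanish.\<close>

lemma sigma_pow_0 [simp]: "sigma_pow s 0 = 0"
  by (simp add: sigma_pow_def)

text \<open>A divisor a of i and a divisor b of n - i carry cofactors x and y with i = a x and n - i
  = b y.\<close>

lemma sigma_fps_mult_nth:
  "fps_nth (sigma_fps s * sigma_fps t) n = rep_sum n (\<lambda>a b. of_nat a ^ s * of_nat b ^ t)"
proof -
  have sigma: "of_nat (sigma_pow s m) = (\<Sum>a | a dvd m. (of_nat a ^ s :: complex))" for s m
    by (simp add: sigma_pow_def)
  have "fps_nth (sigma_fps s * sigma_fps t) n =
      (\<Sum>i = 1..<n. of_nat (sigma_pow s i) * of_nat (sigma_pow t (n - i)))"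
    unfolding fps_mult_nth sigma_fps_def
  proof (rule sum.mono_neutral_cong_right)
    show "\<forall>i\<in>{0..n} - {1..<n}. fps_nth (Abs_fps (\<lambda>n. complex_of_nat (sigma_pow s n))) i *
        fps_nth (Abs_fps (\<lambda>n. complex_of_nat (sigma_pow t n))) (n - i) = 0"
    proof
      fix i assume "i \<in> {0..n} - {1..<n}"
      hence "i = 0 \<or> i = n" by auto
      thus "fps_nth (Abs_fps (\<lambda>n. complex_of_nat (sigma_pow s n))) i *
        fps_nth (Abs_fps (\<lambda>n. complex_of_nat (sigma_pow t n))) (n - i) = 0" by auto
    qed
  qed auto
  also have "\<dots> = (\<Sum>i = 1..<n. \<Sum>(a, b) \<in> {a. a dvd i} \<times> {b. b dvd n - i}. of_nat a ^ s * of_nat b ^ t)"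
    by (simp add: sigma sum_product sum.cartesian_product)
  also have "\<dots> = (\<Sum>(i, a, b) \<in> (SIGMA i:{1..<n}. {a. a dvd i} \<times> {b. b dvd n - i}).
      of_nat a ^ s * of_nat b ^ t)"
    by (subst sum.Sigma) (auto simp: case_prod_unfold)
  also have "\<dots> = rep_sum n (\<lambda>a b. of_nat a ^ s * of_nat b ^ t)"
    unfolding rep_sum_def
    by (rule sum.reindex_bij_witness[where
        i = "\<lambda>(a, b, x, y). (a * x, a, b)" and j = "\<lambda>(i, a, b). (a, b, i div a, (n - i) div b)"])
       (auto simp: weighted_reps_def elim!: dvdE intro!: gr0I split: if_splits, linarith?)
  finally show ?thesis .
qed

lemma sum_from_1: "(d :: nat) > 0 \<Longrightarrow> (\<Sum>a = 1..<d. g a) = (\<Sum>a<d. g a) - (g 0 :: complex)"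
  using sum.atLeast_Suc_lessThan[of 0 d g] by (simp add: lessThan_atLeast0)

text \<open>The parameter \<open>D\<close> is kept apart from the limit \<open>n\<close> so that
  induction on \<open>n\<close> works; both become the same divisor later. The fractions are the
  sums of like powers of a < n.\<close>

lemma sum_quadratic_form:
  fixes D :: complex
  shows "(\<Sum>a<n. D ^ 2 - of_nat a * D + of_nat a ^ 2) =
    (let N = of_nat n in D ^ 2 * N - D * (N ^ 2 - N) / 2 + (2 * N ^ 3 - 3 * N ^ 2 + N) / 6)"
  by (induction n) (simp_all add: Let_def field_simps eval_nat_numeral)

lemma sum_quadratic_form_sq:
  fixes D :: complex
  shows "(\<Sum>a<n. (D ^ 2 - of_nat a * D + of_nat a ^ 2) ^ 2) =
    (let N = of_nat n in D ^ 4 * N - 2 * D ^ 3 * ((N ^ 2 - N) / 2)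
       + 3 * D ^ 2 * ((2 * N ^ 3 - 3 * N ^ 2 + N) / 6) - 2 * D * ((N ^ 4 - 2 * N ^ 3 + N ^ 2) / 4)
       + (6 * N ^ 5 - 15 * N ^ 4 + 10 * N ^ 3 - N) / 30)"
  by (induction n) (simp_all add: Let_def field_simps eval_nat_numeral)

lemma sum_quadratic_form_cube:
  fixes D :: complex
  shows "(\<Sum>a<n. (D ^ 2 - of_nat a * D + of_nat a ^ 2) ^ 3) =
    (let N = of_nat n in D ^ 6 * N - 3 * D ^ 5 * ((N ^ 2 - N) / 2)
       + 6 * D ^ 4 * ((2 * N ^ 3 - 3 * N ^ 2 + N) / 6) - 7 * D ^ 3 * ((N ^ 4 - 2 * N ^ 3 + N ^ 2) / 4)
       + 6 * D ^ 2 * ((6 * N ^ 5 - 15 * N ^ 4 + 10 * N ^ 3 - N) / 30)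
       - 3 * D * ((2 * N ^ 6 - 6 * N ^ 5 + 5 * N ^ 4 - N ^ 2) / 12)
       + (6 * N ^ 7 - 21 * N ^ 6 + 21 * N ^ 5 - 7 * N ^ 3 + N) / 42)"
  by (induction n) (simp_all add: Let_def field_simps eval_nat_numeral)

lemma sum_product_sq:
  fixes D :: complex
  shows "(\<Sum>a<n. of_nat a ^ 2 * (D - of_nat a) ^ 2) =
    (let N = of_nat n in D ^ 2 * ((2 * N ^ 3 - 3 * N ^ 2 + N) / 6)
       - 2 * D * ((N ^ 4 - 2 * N ^ 3 + N ^ 2) / 4)
       + (6 * N ^ 5 - 15 * N ^ 4 + 10 * N ^ 3 - N) / 30)"
  by (induction n) (simp_all add: Let_def field_simps eval_nat_numeral)

text \<open>Since (n div d) d^(k+1) = n d^k, the diagonal of \<open>h\<close> produces a divisor sum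
  of exponent \<open>k\<close>. In the applications, the d^(k+1) split off in the last hypothesis is
  the absent term a = 0 of the inner sum; it cancels against the - 1 in n div d - 1.\<close>

lemma rep_sum_descent_power:
  assumes "n > 0" and "\<And>a b. h a (a + b) = f a b" and "\<And>a b. h (a + b) b = f a b"
    and diag: "\<And>d. h d d = of_nat d ^ Suc k"
    and f: "\<And>d. d > 0 \<Longrightarrow> (\<Sum>a = 1..<d. f a (d - a)) = p d - of_nat d ^ Suc k"
  shows "rep_sum n (\<lambda>a b. f a b - h a b) = (\<Sum>d | d dvd n. p d) - of_nat n * of_nat (sigma_pow k n)"
proof -
  have "(of_nat (n div d) - 1) * h d d = of_nat n * of_nat d ^ k - of_nat d ^ Suc k" if "d dvd n" for d
  proof -
    have "of_nat (n div d) * (of_nat d :: complex) = of_nat n"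
      using that by (simp flip: of_nat_mult)
    thus ?thesis by (simp add: diag algebra_simps flip: mult.assoc)
  qed
  hence "(\<Sum>d | d dvd n. (of_nat (n div d) - 1) * h d d) =
      of_nat n * of_nat (sigma_pow k n) - (\<Sum>d | d dvd n. of_nat d ^ Suc k)"
    by (simp add: sum_subtractf sigma_pow_def sum_distrib_left)
  moreover have "(\<Sum>d | d dvd n. \<Sum>a = 1..<d. f a (d - a)) =
      (\<Sum>d | d dvd n. p d) - (\<Sum>d | d dvd n. of_nat d ^ Suc k)"
    unfolding sum_subtractf [symmetric]
    by (intro sum.cong refl f) (use assms(1) dvd_pos_nat in blast)
  ultimately show ?thesis
    using rep_sum_descent[OF assms(1-3)] by simp
qed

lemma rep_sum_linear:
  "rep_sum n (\<lambda>a b. f a b + g a b) = rep_sum n f + rep_sum n g"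
  "rep_sum n (\<lambda>a b. c * f a b) = c * rep_sum n f"
  by (simp_all add: rep_sum_def case_prod_unfold sum.distrib sum_distrib_left)

lemma of_nat_sigma_pow: "of_nat (sigma_pow s n) = (\<Sum>d | d dvd n. (of_nat d :: complex) ^ s)"
  by (simp add: sigma_pow_def)

lemma quadratic_form_on_line:
  assumes "a < d"
  shows "(of_nat a :: complex) ^ 2 + of_nat a * of_nat (d - a) + of_nat (d - a) ^ 2 =
         of_nat d ^ 2 - of_nat a * of_nat d + of_nat a ^ 2"
  using assms by (simp add: of_nat_diff algebra_simps power2_eq_square)

text \<open>Both a -> a + b and b -> a + b turn a^2 - a b + b^2 into a^2 + a b + b^2, so this form
  and its powers are admissible for the descent. The first power gives the difference 2 a b.\<close>

lemma sigma_1_1: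
  assumes "n > 0"
  shows "12 * fps_nth (sigma_fps 1 * sigma_fps 1) n =
    5 * of_nat (sigma_pow 3 n) + (1 - 6 * of_nat n) * of_nat (sigma_pow 1 n)"
proof -
  let ?f = "\<lambda>a b. (of_nat a :: complex) ^ 2 + of_nat a * of_nat b + of_nat b ^ 2"
  let ?h = "\<lambda>a b. (of_nat a :: complex) ^ 2 - of_nat a * of_nat b + of_nat b ^ 2"
  have "rep_sum n (\<lambda>a b. ?f a b - ?h a b) =
      (\<Sum>d | d dvd n. 5 / 6 * of_nat d ^ 3 + 1 / 6 * of_nat d ^ 1) - of_nat n * of_nat (sigma_pow 1 n)"
  proof (rule rep_sum_descent_power[OF assms])
    fix d :: nat assume "d > 0"
    have "(\<Sum>a = 1..<d. ?f a (d - a)) = (\<Sum>a = 1..<d. of_nat d ^ 2 - of_nat a * of_nat d + of_nat a ^ 2)"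
      by (intro sum.cong refl quadratic_form_on_line) auto
    also have "\<dots> = 5 / 6 * of_nat d ^ 3 + 1 / 6 * of_nat d ^ 1 - of_nat d ^ Suc 1"
      by (simp only: sum_from_1[OF \<open>d > 0\<close>] sum_quadratic_form) (simp add: Let_def field_simps eval_nat_numeral)
    finally show "(\<Sum>a = 1..<d. ?f a (d - a)) = 5 / 6 * of_nat d ^ 3 + 1 / 6 * of_nat d ^ 1 - of_nat d ^ Suc 1" .
  qed (simp_all add: algebra_simps power2_eq_square)
  moreover have "rep_sum n (\<lambda>a b. ?f a b - ?h a b) = 2 * rep_sum n (\<lambda>a b. of_nat a ^ 1 * of_nat b ^ 1)"
    unfolding rep_sum_linear[symmetric] by (rule arg_cong[where f = "rep_sum n"]) (simp add: fun_eq_iff)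
  ultimately show ?thesis
    unfolding sigma_fps_mult_nth of_nat_sigma_pow sum.distrib sum_distrib_left[symmetric]
    by (simp add: field_simps)
qed

lemma rep_sum_swap: "rep_sum n (\<lambda>a b. f b a) = rep_sum n f"
  unfolding rep_sum_def
  by (rule sum.reindex_bij_witness[where
        i = "\<lambda>(a, b, x, y). (b, a, y, x)" and j = "\<lambda>(a, b, x, y). (b, a, y, x)"])
     (auto simp: weighted_reps_def)

lemma sigma_1_3:
  assumes "n > 0"
  shows "240 * fps_nth (sigma_fps 1 * sigma_fps 3) n =
    21 * of_nat (sigma_pow 5 n) + (10 - 30 * of_nat n) * of_nat (sigma_pow 3 n) - of_nat (sigma_pow 1 n)"
proof -
  let ?f = "\<lambda>a b. ((of_nat a :: complex) ^ 2 + of_nat a * of_nat b + of_nat b ^ 2) ^ 2"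
  let ?h = "\<lambda>a b. ((of_nat a :: complex) ^ 2 - of_nat a * of_nat b + of_nat b ^ 2) ^ 2"
  let ?p = "\<lambda>d. 7 / 10 * (of_nat d :: complex) ^ 5 + (1 / 3 * of_nat d ^ 3 + (- 1 / 30) * of_nat d ^ 1)"
  have "rep_sum n (\<lambda>a b. ?f a b - ?h a b) = (\<Sum>d | d dvd n. ?p d) - of_nat n * of_nat (sigma_pow 3 n)"
  proof (rule rep_sum_descent_power[OF assms])
    fix d :: nat assume "d > 0"
    have "(\<Sum>a = 1..<d. ?f a (d - a)) = (\<Sum>a = 1..<d. (of_nat d ^ 2 - of_nat a * of_nat d + of_nat a ^ 2) ^ 2)"
      by (intro sum.cong refl arg_cong[where f = "\<lambda>x. x ^ 2"] quadratic_form_on_line) auto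
    also have "\<dots> = ?p d - of_nat d ^ Suc 3"
      by (simp only: sum_from_1[OF \<open>d > 0\<close>] sum_quadratic_form_sq) (simp add: Let_def field_simps eval_nat_numeral)
    finally show "(\<Sum>a = 1..<d. ?f a (d - a)) = ?p d - of_nat d ^ Suc 3" .
  qed (simp_all add: algebra_simps eval_nat_numeral)
  moreover have "rep_sum n (\<lambda>a b. ?f a b - ?h a b) =
      4 * rep_sum n (\<lambda>a b. of_nat a ^ 1 * of_nat b ^ 3) + 4 * rep_sum n (\<lambda>a b. of_nat b ^ 1 * of_nat a ^ 3)"
    unfolding rep_sum_linear[symmetric]
    by (rule arg_cong[where f = "rep_sum n"]) (simp add: fun_eq_iff field_simps eval_nat_numeral)
  ultimately show ?thesis
    unfolding sigma_fps_mult_nth of_nat_sigma_pow sum.distrib sum_distrib_left[symmetric]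
      rep_sum_swap[of n "\<lambda>a b. of_nat a ^ 1 * of_nat b ^ 3"]
    by (simp add: field_simps)
qed

text \<open>The cubes differ by 6 a b^5 + 6 a^5 b + 14 a^3 b^3, so this descent sees the two
  convolutions only together; another one separates them.\<close>

lemma sigma_1_5_and_3_3:
  assumes "n > 0"
  shows "420 * (12 * fps_nth (sigma_fps 1 * sigma_fps 5) n + 14 * fps_nth (sigma_fps 3 * sigma_fps 3) n) =
    249 * of_nat (sigma_pow 7 n) + (210 - 420 * of_nat n) * of_nat (sigma_pow 5 n)
      - 49 * of_nat (sigma_pow 3 n) + 10 * of_nat (sigma_pow 1 n)"
proof -
  let ?f = "\<lambda>a b. ((of_nat a :: complex) ^ 2 + of_nat a * of_nat b + of_nat b ^ 2) ^ 3"
  let ?h = "\<lambda>a b. ((of_nat a :: complex) ^ 2 - of_nat a * of_nat b + of_nat b ^ 2) ^ 3"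
  let ?p = "\<lambda>d. 83 / 140 * (of_nat d :: complex) ^ 7 + (1 / 2 * of_nat d ^ 5
    + ((- 7 / 60) * of_nat d ^ 3 + 1 / 42 * of_nat d ^ 1))"
  have "rep_sum n (\<lambda>a b. ?f a b - ?h a b) = (\<Sum>d | d dvd n. ?p d) - of_nat n * of_nat (sigma_pow 5 n)"
  proof (rule rep_sum_descent_power[OF assms])
    fix d :: nat assume "d > 0"
    have "(\<Sum>a = 1..<d. ?f a (d - a)) = (\<Sum>a = 1..<d. (of_nat d ^ 2 - of_nat a * of_nat d + of_nat a ^ 2) ^ 3)"
      by (intro sum.cong refl arg_cong[where f = "\<lambda>x. x ^ 3"] quadratic_form_on_line) auto
    also have "\<dots> = ?p d - of_nat d ^ Suc 5"
      by (simp only: sum_from_1[OF \<open>d > 0\<close>] sum_quadratic_form_cube) (simp add: Let_def field_simps eval_nat_numeral)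
    finally show "(\<Sum>a = 1..<d. ?f a (d - a)) = ?p d - of_nat d ^ Suc 5" .
  qed (simp_all add: algebra_simps eval_nat_numeral)
  moreover have "rep_sum n (\<lambda>a b. ?f a b - ?h a b) =
      6 * rep_sum n (\<lambda>a b. of_nat a ^ 1 * of_nat b ^ 5) + (6 * rep_sum n (\<lambda>a b. of_nat b ^ 1 * of_nat a ^ 5)
      + 14 * rep_sum n (\<lambda>a b. of_nat a ^ 3 * of_nat b ^ 3))"
    unfolding rep_sum_linear[symmetric]
    by (rule arg_cong[where f = "rep_sum n"]) (simp add: fun_eq_iff field_simps eval_nat_numeral)
  ultimately show ?thesis
    unfolding sigma_fps_mult_nth of_nat_sigma_pow sum.distrib sum_distrib_left[symmetric]
      rep_sum_swap[of n "\<lambda>a b. of_nat a ^ 1 * of_nat b ^ 5"]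
    by (simp add: field_simps)
qed

text \<open>This \<open>?h\<close> is admissible too, vanishes for a = b, and leaves 4 a^3 b^3
  alone. The result says that E4^2 is the Eisenstein series of weight 8.\<close>

lemma sigma_3_3:
  assumes "n > 0"
  shows "120 * fps_nth (sigma_fps 3 * sigma_fps 3) n = of_nat (sigma_pow 7 n) - of_nat (sigma_pow 3 n)"
proof -
  let ?f = "\<lambda>a b. (of_nat a :: complex) ^ 2 * of_nat b ^ 2 * (of_nat a + of_nat b) ^ 2"
  let ?h = "\<lambda>a b. (of_nat a :: complex) ^ 2 * of_nat b ^ 2 * (of_nat a - of_nat b) ^ 2"
  have inner: "(\<Sum>a = 1..<d. ?f a (d - a)) = 1 / 30 * of_nat d ^ 7 + (- 1 / 30) * of_nat d ^ 3"
    if "d > 0" for d :: nat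
  proof -
    have "(\<Sum>a = 1..<d. ?f a (d - a)) = (\<Sum>a = 1..<d. of_nat d ^ 2 * (of_nat a ^ 2 * (of_nat d - of_nat a) ^ 2))"
      by (intro sum.cong refl) (auto simp: of_nat_diff)
    also have "\<dots> = 1 / 30 * of_nat d ^ 7 + (- 1 / 30) * of_nat d ^ 3"
      by (simp only: sum_distrib_left[symmetric] sum_from_1[OF that] sum_product_sq)
         (simp add: Let_def field_simps eval_nat_numeral)
    finally show ?thesis .
  qed
  have "rep_sum n (\<lambda>a b. ?f a b - ?h a b) =
      (\<Sum>d | d dvd n. \<Sum>a = 1..<d. ?f a (d - a)) - (\<Sum>d | d dvd n. (of_nat (n div d) - 1) * ?h d d)"
    by (rule rep_sum_descent[OF assms]) (simp_all add: algebra_simps)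
  also have "(\<Sum>d | d dvd n. \<Sum>a = 1..<d. ?f a (d - a)) =
      (\<Sum>d | d dvd n. 1 / 30 * of_nat d ^ 7 + (- 1 / 30) * of_nat d ^ 3)"
    by (intro sum.cong refl inner) (use assms dvd_pos_nat in blast)
  also have "rep_sum n (\<lambda>a b. ?f a b - ?h a b) = 4 * rep_sum n (\<lambda>a b. of_nat a ^ 3 * of_nat b ^ 3)"
    unfolding rep_sum_linear[symmetric]
    by (rule arg_cong[where f = "rep_sum n"]) (simp add: fun_eq_iff field_simps eval_nat_numeral)
  finally show ?thesis
    unfolding sigma_fps_mult_nth of_nat_sigma_pow sum.distrib sum_distrib_left[symmetric]
    by (simp add: field_simps)
qed

section \<open>Ramanujan's differential equations and the modular invariant\<close>

definition theta :: "complex fls \<Rightarrow> complex fls" where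
  "theta f = fls_X * fls_deriv f"

lemma theta_add: "theta (f + g) = theta f + theta g"
  and theta_diff: "theta (f - g) = theta f - theta g"
  and theta_mult: "theta (f * g) = theta f * g + f * theta g"
  and theta_const [simp]: "theta (fls_const c) = 0"
  by (simp_all add: theta_def algebra_simps)

lemma theta_numeral [simp]: "theta (numeral n) = 0"
  by (simp add: theta_def)

lemma theta_square: "theta (f ^ 2) = 2 * f * theta f"
  and theta_cube: "theta (f ^ 3) = 3 * f ^ 2 * theta f"
  by (simp_all add: eval_nat_numeral theta_mult algebra_simps)

definition eisenstein_fps :: "complex \<Rightarrow> nat \<Rightarrow> complex fps" where
  "eisenstein_fps c s = 1 + fps_const c * sigma_fps s"

lemma eisenstein_eq: "eisenstein c s = fps_to_fls (eisenstein_fps c s)"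
  unfolding eisenstein_def
  by (rule arg_cong[where f = fps_to_fls]) (auto simp: fps_eq_iff eisenstein_fps_def sigma_fps_def)

lemma sigma_fps_nth [simp]: "fps_nth (sigma_fps s) n = of_nat (sigma_pow s n)"
  by (simp add: sigma_fps_def)

lemma eisenstein_fps_nth:
  "fps_nth (eisenstein_fps c s) 0 = 1"
  "n > 0 \<Longrightarrow> fps_nth (eisenstein_fps c s) n = c * of_nat (sigma_pow s n)"
  by (simp_all add: eisenstein_fps_def)

lemma eisenstein_fps_mult_nth:
  "n > 0 \<Longrightarrow> fps_nth (eisenstein_fps c s * eisenstein_fps d t) n =
     d * fps_nth (sigma_fps t) n + c * fps_nth (sigma_fps s) n + c * d * fps_nth (sigma_fps s * sigma_fps t) n"
proof -
  assume "n > 0"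
  have "eisenstein_fps c s * eisenstein_fps d t = 1 + fps_const d * sigma_fps t + fps_const c * sigma_fps s
      + fps_const (c * d) * (sigma_fps s * sigma_fps t)"
    by (simp add: eisenstein_fps_def algebra_simps flip: fps_const_mult)
  thus ?thesis
    using \<open>n > 0\<close> by (simp only: fps_add_nth fps_mult_left_const_nth) simp
qed

lemma theta_eisenstein:
  "theta (fps_to_fls (eisenstein_fps c s)) = fps_to_fls (Abs_fps (\<lambda>n. of_nat n * (c * fps_nth (sigma_fps s) n)))"
  by (rule fls_eqI)
     (auto simp: theta_def eisenstein_fps_def fls_X_times_conv_shift sigma_fps_def of_nat_nat)

lemma ramanujan_E2: "fls_const 12 * theta E2 = E2 * E2 - E4"
proof -
  have "fps_const 12 * Abs_fps (\<lambda>n. of_nat n * (- 24 * fps_nth (sigma_fps 1) n)) =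
      eisenstein_fps (- 24) 1 * eisenstein_fps (- 24) 1 - eisenstein_fps 240 3"
  proof (rule fps_ext)
    fix n
    show "fps_nth (fps_const 12 * Abs_fps (\<lambda>n. of_nat n * (- 24 * fps_nth (sigma_fps 1) n))) n =
      fps_nth (eisenstein_fps (- 24) 1 * eisenstein_fps (- 24) 1 - eisenstein_fps 240 3) n"
    proof (cases "n = 0")
      case True
      thus ?thesis by (simp add: eisenstein_fps_def)
    next
      case False
      thus ?thesis
        using sigma_1_1[of n] by (simp add: eisenstein_fps_mult_nth eisenstein_fps_nth) algebra
    qed
  qed
  from arg_cong[OF this, of fps_to_fls] show ?thesis
    by (simp add: E2_def E4_def theta_eisenstein eisenstein_eq fls_times_fps_to_fls)
qed

lemma ramanujan_E4: "fls_const 3 * theta E4 = E2 * E4 - E6"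
proof -
  have "fps_const 3 * Abs_fps (\<lambda>n. of_nat n * (240 * fps_nth (sigma_fps 3) n)) =
      eisenstein_fps (- 24) 1 * eisenstein_fps 240 3 - eisenstein_fps (- 504) 5"
  proof (rule fps_ext)
    fix n
    show "fps_nth (fps_const 3 * Abs_fps (\<lambda>n. of_nat n * (240 * fps_nth (sigma_fps 3) n))) n =
      fps_nth (eisenstein_fps (- 24) 1 * eisenstein_fps 240 3 - eisenstein_fps (- 504) 5) n"
    proof (cases "n = 0")
      case True
      thus ?thesis by (simp add: eisenstein_fps_def)
    next
      case False
      thus ?thesis
        using sigma_1_3[of n] by (simp add: eisenstein_fps_mult_nth eisenstein_fps_nth) algebra
    qed
  qed
  from arg_cong[OF this, of fps_to_fls] show ?thesis
    by (simp add: E2_def E4_def E6_def theta_eisenstein eisenstein_eq fls_times_fps_to_fls)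
qed

text \<open>In both products the divisor sum of exponent 7 occurs with coefficient 480, so it
  cancels in the difference.\<close>

lemma ramanujan_E6: "fls_const 2 * theta E6 = E2 * E6 - E4 * E4"
proof -
  have "fps_const 2 * Abs_fps (\<lambda>n. of_nat n * (- 504 * fps_nth (sigma_fps 5) n)) =
      eisenstein_fps (- 24) 1 * eisenstein_fps (- 504) 5 - eisenstein_fps 240 3 * eisenstein_fps 240 3"
  proof (rule fps_ext)
    fix n
    show "fps_nth (fps_const 2 * Abs_fps (\<lambda>n. of_nat n * (- 504 * fps_nth (sigma_fps 5) n))) n =
      fps_nth (eisenstein_fps (- 24) 1 * eisenstein_fps (- 504) 5 - eisenstein_fps 240 3 * eisenstein_fps 240 3) n"
    proof (cases "n = 0")
      case True
      thus ?thesis by (simp add: eisenstein_fps_def)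
    next
      case False
      thus ?thesis
        using sigma_1_5_and_3_3[of n] sigma_3_3[of n]
        by (simp add: eisenstein_fps_mult_nth eisenstein_fps_nth) algebra
    qed
  qed
  from arg_cong[OF this, of fps_to_fls] show ?thesis
    by (simp add: E2_def E4_def E6_def theta_eisenstein eisenstein_eq fls_times_fps_to_fls)
qed

section \<open>Orders and leading coefficients\<close>

definition has_lead :: "int \<Rightarrow> complex fls \<Rightarrow> bool" where
  "has_lead n f \<longleftrightarrow> fls_subdegree f = n \<and> fls_nth f n = 1"

lemma has_lead_nonzero: "has_lead n f \<Longrightarrow> f \<noteq> 0"
  by (auto simp: has_lead_def)

lemma has_leadI: "(\<And>i. i < n \<Longrightarrow> fls_nth f i = 0) \<Longrightarrow> fls_nth f n = 1 \<Longrightarrow> has_lead n f"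
  unfolding has_lead_def by (auto intro: fls_subdegree_eqI)

lemma has_lead_below: "has_lead n f \<Longrightarrow> i < n \<Longrightarrow> fls_nth f i = 0"
  by (auto simp: has_lead_def)

lemma has_lead_mult: "has_lead m f \<Longrightarrow> has_lead n g \<Longrightarrow> has_lead (m + n) (f * g)"
  using has_lead_nonzero[of m f] has_lead_nonzero[of n g] fls_times_base[of f g]
  by (auto simp: has_lead_def)

lemma has_lead_1 [simp]: "has_lead 0 1"
  by (simp add: has_lead_def)

lemma has_lead_inverse:
  assumes "has_lead n f"
  shows "has_lead (- n) (inverse f)"
proof -
  have nz: "f \<noteq> 0" using assms by (rule has_lead_nonzero)
  have one: "f * inverse f = 1" using nz by simp
  have "fls_subdegree f + fls_subdegree (inverse f) = 0"
    using fls_subdegree_mult[of f "inverse f"] nz by (simp add: one del: fls_inverse_subdegree)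
  moreover from this have "fls_nth f (fls_subdegree f) * fls_nth (inverse f) (fls_subdegree (inverse f)) = 1"
    using fls_times_base[of f "inverse f"] one by simp
  ultimately show ?thesis
    using assms by (auto simp: has_lead_def add_eq_0_iff)
qed

lemma has_lead_power: "has_lead n f \<Longrightarrow> has_lead (int k * n) (f ^ k)"
  by (induction k) (auto simp: algebra_simps intro: has_lead_mult)

lemma has_lead_powi: "has_lead n f \<Longrightarrow> has_lead (k * n) (f powi k)"
proof (cases "k \<ge> 0")
  case False
  assume "has_lead n f"
  hence "has_lead (int (nat (- k)) * (- n)) (inverse f ^ nat (- k))"
    by (intro has_lead_power has_lead_inverse)
  thus ?thesis using False by (simp add: power_int_def)
qed (use has_lead_power[of n f "nat k"] in \<open>simp add: power_int_def\<close>)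

lemma has_lead_divide: "has_lead m f \<Longrightarrow> has_lead n g \<Longrightarrow> has_lead (m - n) (f / g)"
  using has_lead_mult[OF _ has_lead_inverse, of m f n g] by (simp add: field_class.field_divide_inverse)

lemma has_lead_eisenstein: "has_lead 0 (eisenstein c s)"
  by (rule has_leadI) (auto simp: eisenstein_def)

lemma has_lead_E2: "has_lead 0 E2" and has_lead_E4: "has_lead 0 E4" and has_lead_E6: "has_lead 0 E6"
  by (simp_all add: E2_def E4_def E6_def has_lead_eisenstein)

lemma Delta_eq: "1728 * Delta = E4 ^ 3 - E6 ^ 2"
  by (simp add: Delta_def)

lemma has_lead_Delta: "has_lead 1 Delta"
proof (rule has_leadI)
  define D where "D = eisenstein_fps 240 3 ^ 3 - eisenstein_fps (- 504) 5 ^ 2"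
  have D: "E4 ^ 3 - E6 ^ 2 = fps_to_fls D"
    by (simp add: E4_def E6_def eisenstein_eq D_def fps_to_fls_power)
  have nth: "1728 * fls_nth Delta i = fls_nth (fps_to_fls D) i" for i
    using arg_cong[OF Delta_eq, of "\<lambda>f. fls_nth f i"] by (simp add: D)
  have "sigma_pow s 1 = 1" for s by (simp add: sigma_pow_def)
  \<comment> \<open>The linear coefficient is 3 * 240 + 2 * 504 = 1728.\<close>
  hence "fps_nth D 0 = 0" "fps_nth D 1 = 1728"
    by (simp_all add: D_def fps_mult_nth eisenstein_fps_nth numeral_eq_Suc)
  thus "fls_nth Delta 1 = 1" "i < 1 \<Longrightarrow> fls_nth Delta i = 0" for i
    using nth[of 1] nth[of i] by (auto split: if_splits)
qed

lemma has_lead_klein_j: "has_lead (- 1) klein_j"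
  unfolding klein_j_def using has_lead_divide[OF has_lead_power[OF has_lead_E4, of 3] has_lead_Delta] by simp

lemma forms_nonzero [simp]: "E2 \<noteq> 0" "E4 \<noteq> 0" "E6 \<noteq> 0" "Delta \<noteq> 0" "klein_j \<noteq> 0"
  using has_lead_nonzero has_lead_E2 has_lead_E4 has_lead_E6 has_lead_Delta has_lead_klein_j by blast+

lemma klein_j_Delta: "klein_j * Delta = E4 ^ 3"
  by (simp add: klein_j_def)

lemma klein_j_minus_1728: "(klein_j - 1728) * Delta = E6 ^ 2"
  using Delta_eq by (simp add: left_diff_distrib klein_j_Delta)

text \<open>As \<open>klein_j\<close> has weight 0, the contributions of \<open>E2\<close> to the
  derivatives of E4^3 and of \<open>Delta\<close> cancel.\<close>

lemma theta_klein_j: "theta klein_j * Delta = - (E4 ^ 2 * E6)"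
proof -
  have D: "1728 * theta Delta = 3 * E4 ^ 2 * theta E4 - 2 * E6 * theta E6"
    using arg_cong[OF Delta_eq, of theta] by (simp add: theta_mult theta_diff theta_square theta_cube)
  have J: "theta klein_j * Delta + klein_j * theta Delta = 3 * E4 ^ 2 * theta E4"
    using arg_cong[OF klein_j_Delta, of theta] by (simp add: theta_mult theta_cube)
  have "3 * theta E4 = E2 * E4 - E6" "2 * theta E6 = E2 * E6 - E4 * E4"
    using ramanujan_E4 ramanujan_E6 by simp_all
  hence "1728 * (theta klein_j * Delta) * Delta = 1728 * (- (E4 ^ 2 * E6)) * Delta"
    using D J klein_j_Delta Delta_eq by algebra
  thus ?thesis by (metis forms_nonzero(4) mult_right_cancel mult_left_cancel zero_neq_numeral)
qed

lemma theta_klein_j': "theta klein_j * E4 = - (klein_j * E6)"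
proof -
  have "theta klein_j * E4 * Delta = - (klein_j * E6) * Delta"
    using theta_klein_j klein_j_Delta by algebra
  thus ?thesis using forms_nonzero(4) mult_right_cancel by blast
qed

section \<open>Polynomials in the modular invariant\<close>

lemma at_j_0 [simp]: "at_j 0 = 0"
  and at_j_1 [simp]: "at_j 1 = 1"
  and at_j_pCons [simp]: "at_j (pCons a p) = fls_const a + klein_j * at_j p"
  by (simp_all add: at_j_def map_poly_pCons map_poly_1)

lemma at_j_add [simp]: "at_j (p + q) = at_j p + at_j q"
proof (induction p arbitrary: q)
  case (pCons a p)
  show ?case by (cases q) (simp add: pCons.IH distrib_left flip: fls_plus_const)
qed simp

lemma at_j_smult [simp]: "at_j (smult c p) = fls_const c * at_j p"
  by (induction p) (simp_all add: algebra_simps)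

lemma at_j_uminus [simp]: "at_j (- p) = - at_j p"
  using at_j_smult[of "- 1" p] by simp

lemma at_j_diff [simp]: "at_j (p - q) = at_j p - at_j q"
  using at_j_add[of p "- q"] by simp

lemma at_j_mult [simp]: "at_j (p * q) = at_j p * at_j q"
  by (induction p) (simp_all add: algebra_simps)

lemma at_j_sum: "at_j (sum f S) = (\<Sum>x\<in>S. at_j (f x))"
  by (induction S rule: infinite_finite_induct) simp_all

lemma theta_at_j: "theta (at_j p) = at_j (pderiv p) * theta klein_j"
proof (induction p)
  case 0
  show ?case by (simp add: theta_def)
next
  case (pCons a p)
  thus ?case by (simp add: theta_add theta_mult pderiv_pCons algebra_simps)
qed

lemma at_j_monom [simp]: "at_j (monom c i) = fls_const c * klein_j ^ i"
  by (induction i) (simp_all add: monom_0 monom_Suc)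

lemma at_j_order:
  assumes "degree p \<le> n"
  shows "i < - int n \<Longrightarrow> fls_nth (at_j p) i = 0" and "fls_nth (at_j p) (- int n) = coeff p n"
proof -
  have lead: "has_lead (- int k) (klein_j ^ k)" for k
    using has_lead_power[OF has_lead_klein_j, of k] by simp
  have "at_j p = at_j (\<Sum>k\<le>n. monom (coeff p k) k)"
    using poly_as_sum_of_monoms'[OF assms] by simp
  hence nth: "fls_nth (at_j p) i = (\<Sum>k\<le>n. coeff p k * fls_nth (klein_j ^ k) i)" for i
    by (simp add: at_j_sum fls_nth_sum)
  show "fls_nth (at_j p) i = 0" if "i < - int n"
    unfolding nth by (rule sum.neutral) (use that in \<open>auto intro!: has_lead_below[OF lead]\<close>)
  have "fls_nth (at_j p) (- int n) = (\<Sum>k\<le>n. if k = n then coeff p n else 0)"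
    unfolding nth by (rule sum.cong) (use lead in \<open>auto simp: has_lead_def intro!: has_lead_below[OF lead]\<close>)
  thus "fls_nth (at_j p) (- int n) = coeff p n" by simp
qed

lemma at_j_eq_0_iff [simp]: "at_j p = 0 \<longleftrightarrow> p = 0"
proof
  assume "at_j p = 0"
  thus "p = 0" using at_j_order(2)[of p "degree p"] by simp
qed simp

section \<open>Irrationality of the weight two Eisenstein series\<close>

lemma at_j_times_has_lead:
  assumes "p \<noteq> 0" and "has_lead m f"
  shows "fls_subdegree (at_j p * f) = m - int (degree p)"
    and "fls_nth (at_j p * f) (m - int (degree p)) = lead_coeff p"
proof -
  have sub: "fls_subdegree (at_j p) = - int (degree p)"
    using assms(1) at_j_order(1)[OF order.refl, of _ p] by (intro fls_subdegree_eqI) (simp_all add: at_j_order(2))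
  moreover have "f \<noteq> 0" using assms(2) by (rule has_lead_nonzero)
  ultimately show *: "fls_subdegree (at_j p * f) = m - int (degree p)"
    using assms by (simp add: has_lead_def)
  show "fls_nth (at_j p * f) (m - int (degree p)) = lead_coeff p"
    using fls_times_base[of "at_j p" f] sub assms(2) by (simp add: has_lead_def at_j_order)
qed

text \<open>
  If \<open>E\<^sub>2 = R(j) E\<^sub>6 / E\<^sub>4\<close>, then Ramanujan's equations turn into a Riccati equation for \<open>R = b / a\<close>.
\<close>

lemma riccati:
  assumes "at_j a * (E2 * E4) = at_j b * E6"
  defines "X \<equiv> [:0, 1:] :: complex poly" and "Y \<equiv> [:- 1728, 1:] :: complex poly"
  shows "12 * X * Y * (pderiv b * a - b * pderiv a) = Y * (b ^ 2 + 4 * a * b) - 6 * X * a * b + X * a ^ 2"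
proof -
  define u where "u = E2 * E4"
  note [simp] = numeral_poly
  have XY: "at_j X = klein_j" "at_j Y = klein_j - 1728"
    by (simp_all add: X_def Y_def)
  have num: "at_j (numeral n) = numeral n" for n
    by simp
  let ?A = "at_j a" and ?B = "at_j b" and ?A' = "at_j (pderiv a)" and ?B' = "at_j (pderiv b)"
  have u: "?A * u = ?B * E6" using assms(1) by (simp add: u_def)
  have "12 * theta E2 = E2 * E2 - E4" "3 * theta E4 = E2 * E4 - E6" "2 * theta E6 = E2 * E6 - E4 * E4"
    using ramanujan_E2 ramanujan_E4 ramanujan_E6 by simp_all
  moreover have "?A' * theta klein_j * E2 * E4 + ?A * (theta E2 * E4 + E2 * theta E4) =
      ?B' * theta klein_j * E6 + ?B * theta E6"
    using arg_cong[OF assms(1), of theta] by (simp add: theta_mult theta_at_j algebra_simps)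
  \<comment> \<open>The differentiated relation times 12 \<open>E4\<close>, with all derivatives of
    Eisenstein series and of \<open>klein_j\<close> eliminated.\<close>
  ultimately have "- 12 * ?A' * klein_j * E6 * u + ?A * (u ^ 2 - E4 ^ 3) + 4 * ?A * (u ^ 2 - u * E6) =
      - 12 * ?B' * klein_j * E6 ^ 2 + 6 * ?B * (u * E6 - E4 ^ 3)"
    using theta_klein_j' unfolding u_def by algebra
  \<comment> \<open>Multiplying by \<open>?A\<close> and replacing \<open>?A * u\<close> by
    \<open>?B * E6\<close> leaves only E6^2 and E4^3, which are \<open>Delta\<close> times
    polynomials in \<open>klein_j\<close>.\<close>
  hence "12 * klein_j * (?B' * ?A - ?B * ?A') * E6 ^ 2 =
      (?B ^ 2 + 4 * ?A * ?B) * E6 ^ 2 + ?A ^ 2 * E4 ^ 3 - 6 * ?A * ?B * E4 ^ 3"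
    using u by algebra
  hence "12 * klein_j * (klein_j - 1728) * (?B' * ?A - ?B * ?A') * Delta =
      ((klein_j - 1728) * (?B ^ 2 + 4 * ?A * ?B) - 6 * klein_j * ?A * ?B + klein_j * ?A ^ 2) * Delta"
    unfolding klein_j_minus_1728[symmetric] klein_j_Delta[symmetric] by (simp add: algebra_simps)
  hence "12 * klein_j * (klein_j - 1728) * (?B' * ?A - ?B * ?A') =
      (klein_j - 1728) * (?B ^ 2 + 4 * ?A * ?B) - 6 * klein_j * ?A * ?B + klein_j * ?A ^ 2"
    by simp
  hence "at_j (12 * X * Y * (pderiv b * a - b * pderiv a) -
      (Y * (b ^ 2 + 4 * a * b) - 6 * X * a * b + X * a ^ 2)) = 0"
    by (simp only: at_j_diff at_j_mult at_j_add XY num power2_eq_square)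
       (simp add: algebra_simps)
  thus ?thesis by (simp only: at_j_eq_0_iff right_minus_eq)
qed

text \<open>The equation allows 12 X a'/a + b/a no pole except at 1728, so this is c/Y with
  \<open>c\<close> linear, say c = d + \<kappa> X. The cusp gives \<kappa> = 12 N + 1, the point 0
  leaves two values of \<open>d\<close>, and the point 1728 then leaves \<kappa> among 0, -4, 6, 2,
  none of which is 1 modulo 12.\<close>

lemma no_rational_riccati_solution:
  assumes "at_j a * (E2 * E4) = at_j b * E6" and "coprime a b" and "a \<noteq> 0"
  shows False
proof -
  define X Y where "X = ([:0, 1:] :: complex poly)" and "Y = ([:- 1728, 1:] :: complex poly)"
  have ric: "12 * X * Y * (pderiv b * a - b * pderiv a) = Y * (b ^ 2 + 4 * a * b) - 6 * X * a * b + X * a ^ 2"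
    using riccati[OF assms(1)] by (simp add: X_def Y_def)
  have poly_XY: "poly X x = x" "poly Y x = x - 1728" for x
    by (simp_all add: X_def Y_def)
  have no_common_root: "\<not> (poly a x = 0 \<and> poly b x = 0)" for x
    using assms(2) by (metis coprime_common_divisor poly_eq_0_iff_dvd is_unit_iff_degree one_neq_zero
        degree_pCons_eq_if degree_0 nat.distinct(1) one_pCons pCons_eq_0_iff)
  define N where "N = degree a"
  have "b \<noteq> 0" using assms(1,3) by auto
  \<comment> \<open>Both \<open>E2 * E4\<close> and \<open>E6\<close> have constant term 1, so b/a
    tends to 1 at the cusp.\<close>
  have lead: "degree b = N" "lead_coeff b = lead_coeff a"
  proof -
    have "has_lead 0 (E2 * E4)" using has_lead_mult[OF has_lead_E2 has_lead_E4] by simp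
    note * = at_j_times_has_lead[OF assms(3) this] at_j_times_has_lead[OF \<open>b \<noteq> 0\<close> has_lead_E6]
    show "degree b = N" using *(1,3) assms(1) by (simp add: N_def)
    thus "lead_coeff b = lead_coeff a" using *(2,4) assms(1) by (simp add: N_def)
  qed
  \<comment> \<open>Modulo \<open>a\<close> the equation reads - 12 X Y b a' = Y b^2, that is, b Y e
    = 0.\<close>
  define e where "e = 12 * X * pderiv a + b"
  have "a dvd b * (Y * e)"
  proof
    show "b * (Y * e) = a * (12 * X * Y * pderiv b - 4 * Y * b + 6 * X * b - X * a)"
      using ric unfolding e_def by algebra
  qed
  hence "a dvd Y * e" using assms(2) by (simp add: coprime_dvd_mult_right_iff)
  then obtain c where c: "Y * e = a * c" by (elim dvdE)
  have coeff_e: "coeff e i = (12 * of_nat i) * coeff a i + coeff b i" for i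
  proof -
    have "X * p = pCons 0 p" for p by (simp add: X_def)
    hence "e = smult 12 (pCons 0 (pderiv a)) + b"
      by (simp add: e_def numeral_poly flip: mult.assoc)
    thus ?thesis by (simp add: coeff_pCons coeff_pderiv split: nat.split)
  qed
  have lc: "coeff e N = (12 * of_nat N + 1) * lead_coeff a"
    using lead by (simp add: coeff_e N_def algebra_simps)
  have nz: "12 * (of_nat N :: complex) + 1 \<noteq> 0"
    using of_nat_eq_0_iff[of "12 * N + 1", where 'a = complex] by (simp add: add.commute)
  have "degree e \<le> N"
  proof (rule degree_le, intro allI impI)
    fix i assume "i > N"
    thus "coeff e i = 0" using coeff_eq_0[of a i] coeff_eq_0[of b i] lead(1) by (simp add: coeff_e flip: N_def)
  qed
  moreover have "coeff e N \<noteq> 0" using lc nz assms(3) by simp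
  ultimately have deg_e: "degree e = N" using le_degree by (metis antisym)
  have "e \<noteq> 0" using \<open>coeff e N \<noteq> 0\<close> by auto
  have "Y \<noteq> 0" "degree Y = 1" "lead_coeff Y = 1" by (simp_all add: Y_def)
  have "c \<noteq> 0" using c \<open>e \<noteq> 0\<close> \<open>Y \<noteq> 0\<close> by auto
  have "degree c = 1"
    using arg_cong[OF c, of degree] degree_mult_eq[OF \<open>Y \<noteq> 0\<close> \<open>e \<noteq> 0\<close>] degree_mult_eq[OF assms(3) \<open>c \<noteq> 0\<close>]
      \<open>degree Y = 1\<close> deg_e by (simp add: N_def)
  have "lead_coeff c = 12 * of_nat N + 1"
    using arg_cong[OF c, of lead_coeff] lc deg_e \<open>lead_coeff Y = 1\<close> assms(3) by (simp add: lead_coeff_mult)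
  hence d: "c = [:coeff c 0, 12 * of_nat N + 1:]"
    using \<open>degree c = 1\<close> by (intro poly_eqI) (auto simp: coeff_pCons coeff_eq_0 split: nat.split)
  define d where "d = coeff c 0"
  define \<kappa> where "\<kappa> = 12 * (of_nat N :: complex) + 1"
  have \<kappa>_neq: "\<kappa> \<noteq> 0" "\<kappa> \<noteq> - 4" "\<kappa> \<noteq> 2" "\<kappa> \<noteq> 6"
  proof -
    have *: "\<kappa> = of_nat (12 * N + 1)" by (simp add: \<kappa>_def)
    show "\<kappa> \<noteq> 0" unfolding * by (simp del: of_nat_add of_nat_mult of_nat_Suc)
    show "\<kappa> \<noteq> 2" "\<kappa> \<noteq> 6"
      unfolding * of_nat_eq_iff[of _ 2, unfolded of_nat_numeral] of_nat_eq_iff[of _ 6, unfolded of_nat_numeral]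
      by presburger+
    show "\<kappa> \<noteq> - 4"
    proof
      assume "\<kappa> = - 4"
      hence "of_nat (12 * N + 5) = (0 :: complex)" by (simp add: \<kappa>_def algebra_simps)
      thus False by (simp only: of_nat_eq_0_iff)
    qed
  qed
  have poly_c: "poly c x = d + \<kappa> * x" for x by (subst d) (simp add: d_def \<kappa>_def)
  have num: "poly (numeral k) x = numeral k" for x :: complex and k :: num by (simp add: numeral_poly)
  \<comment> \<open>At 0 the equation leaves b = 0 or b = - 4 a, while \<open>c\<close> gives - 1728
    b = d a; 6912 is 4 * 1728.\<close>
  have d_cases: "d = 0 \<or> d = 6912"
  proof -
    have "poly b 0 * (poly b 0 + 4 * poly a 0) = 0"
      using arg_cong[OF ric, of "\<lambda>p. poly p 0"] by (simp add: poly_XY num power2_eq_square algebra_simps)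
    moreover have "- 1728 * poly b 0 = poly a 0 * d"
      using arg_cong[OF c, of "\<lambda>p. poly p 0"] by (simp add: poly_XY poly_c e_def)
    moreover from calculation have "poly a 0 ^ 2 * (d * (d - 6912)) = 0" by algebra
    moreover have "poly a 0 \<noteq> 0" using calculation(1) no_common_root[of 0] by auto
    ultimately show ?thesis by simp
  qed
  show False
  proof (cases "poly a 1728 = 0")
    case False
    have "poly a 1728 * (d + \<kappa> * 1728) = 0"
      using arg_cong[OF c, of "\<lambda>p. poly p 1728"] by (simp add: poly_XY poly_c)
    hence "d + \<kappa> * 1728 = 0" using False by simp
    hence "\<kappa> = - (d / 1728)" by (simp add: field_simps add_eq_0_iff)
    thus False using d_cases \<kappa>_neq by auto
  next
    case True
    \<comment> \<open>One factor \<open>Y\<close> cancels from both equations, which can then be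
      evaluated at 1728, where \<open>b\<close> does not vanish. The constants are 20736 = 12 * 1728
      and 10368 = 6 * 1728.\<close>
    then obtain \<alpha> where \<alpha>: "a = Y * \<alpha>" by (auto simp: Y_def poly_eq_0_iff_dvd elim: dvdE)
    have [simp]: "pderiv Y = 1" by (simp add: Y_def pderiv_pCons one_pCons)
    have a': "pderiv a = \<alpha> + Y * pderiv \<alpha>" by (simp add: \<alpha> pderiv_mult)
    let ?\<alpha> = "poly \<alpha> 1728" and ?\<beta> = "poly b 1728"
    have "?\<beta> \<noteq> 0" using no_common_root[of 1728] True by auto
    have "Y * (12 * X * (\<alpha> + Y * pderiv \<alpha>) + b) = Y * (\<alpha> * c)"
      using c unfolding e_def a' by (simp only: \<alpha> mult.assoc)
    hence "12 * X * (\<alpha> + Y * pderiv \<alpha>) + b = \<alpha> * c" using \<open>Y \<noteq> 0\<close> by simp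
    from arg_cong[OF this, of "\<lambda>p. poly p 1728"]
    have 1: "20736 * ?\<alpha> + ?\<beta> = ?\<alpha> * (d + \<kappa> * 1728)" by (simp add: poly_XY poly_c num)
    have "Y * (12 * X * (pderiv b * Y * \<alpha> - b * (\<alpha> + Y * pderiv \<alpha>))) =
        Y * (b ^ 2 + 4 * Y * \<alpha> * b - 6 * X * \<alpha> * b + X * Y * \<alpha> ^ 2)"
      using ric a' \<alpha> by algebra
    hence "12 * X * (pderiv b * Y * \<alpha> - b * (\<alpha> + Y * pderiv \<alpha>)) =
        b ^ 2 + 4 * Y * \<alpha> * b - 6 * X * \<alpha> * b + X * Y * \<alpha> ^ 2"
      using \<open>Y \<noteq> 0\<close> by simp
    from arg_cong[OF this, of "\<lambda>p. poly p 1728"]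
    have "- (?\<alpha> * (?\<beta> * 10368)) = ?\<beta> * ?\<beta>" by (simp add: poly_XY num power2_eq_square algebra_simps)
    hence "?\<beta> * (?\<beta> + 10368 * ?\<alpha>) = 0" by algebra
    hence 2: "?\<beta> = - (10368 * ?\<alpha>)" using \<open>?\<beta> \<noteq> 0\<close> by (simp add: add_eq_0_iff2)
    have "?\<alpha> * (d + \<kappa> * 1728 - 10368) = 0" using 1 2 by (simp add: algebra_simps)
    hence "d + \<kappa> * 1728 = 10368" using 2 \<open>?\<beta> \<noteq> 0\<close> by auto
    hence "\<kappa> = 6 - d / 1728" by (simp add: field_simps)
    thus False using d_cases \<kappa>_neq by auto
  qed
qed

text \<open>The quotient \<open>E2 * E4 / E6\<close> has weight 0, so a rational expression for
  \<open>E2\<close> would make it a rational function of \<open>klein_j\<close>. Removing the common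
  factor of \<open>a\<close> and \<open>b\<close> reaches the coprime case.\<close>

lemma E2_irrational:
  assumes "at_j a * (E2 * E4) = at_j b * E6"
  shows "a = 0" and "b = 0"
proof -
  show "a = 0"
  proof (rule ccontr)
    assume "a \<noteq> 0"
    define g where "g = gcd a b"
    have "g \<noteq> 0" using \<open>a \<noteq> 0\<close> by (simp add: g_def)
    have *: "a = g * (a div g)" "b = g * (b div g)" by (simp_all add: g_def)
    have "at_j g * (at_j (a div g) * (E2 * E4)) = at_j g * (at_j (b div g) * E6)"
      using assms * by (metis at_j_mult mult.assoc)
    hence "at_j (a div g) * (E2 * E4) = at_j (b div g) * E6" using \<open>g \<noteq> 0\<close> by simp
    moreover have "coprime (a div g) (b div g)"
      unfolding g_def using \<open>a \<noteq> 0\<close> by (intro div_gcd_coprime) auto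
    moreover have "a div g \<noteq> 0" using * \<open>a \<noteq> 0\<close> by auto
    ultimately show False by (rule no_rational_riccati_solution)
  qed
  thus "b = 0" using assms by auto
qed

section \<open>Quasimodular forms of depth at most one\<close>

text \<open>The common factor of all modular forms of weight 12 m + 4 \<delta> + 6 \<epsilon>; what
  remains is a polynomial in \<open>klein_j\<close>.\<close>

definition core :: "nat \<Rightarrow> nat \<Rightarrow> int \<Rightarrow> complex fls" where
  "core \<delta> \<epsilon> m = E4 ^ \<delta> * E6 ^ \<epsilon> * Delta powi m"

text \<open>
  If \<open>core \<delta> \<epsilon> m\<close> has weight \<open>w\<close>, then \<open>core (next4 \<delta>) (1 - \<epsilon>) (m + shift \<delta> \<epsilon>)\<close> has weight \<open>w - 2\<close>.
\<close>

definition next4 :: "nat \<Rightarrow> nat" where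
  "next4 \<delta> = (if \<delta> = 2 then 0 else \<delta> + 1)"

definition shift :: "nat \<Rightarrow> nat \<Rightarrow> int" where
  "shift \<delta> \<epsilon> = (if \<delta> = 2 then 1 else 0) - (if \<epsilon> = 0 then 1 else 0)"

text \<open>The weight 0 quotient through which depth one enters. Powers of \<open>Delta\<close>
  cancel, so one series serves all weights in a class modulo 12.\<close>

definition phi :: "nat \<Rightarrow> nat \<Rightarrow> complex fls" where
  "phi \<delta> \<epsilon> = E2 * core (next4 \<delta>) (1 - \<epsilon>) (shift \<delta> \<epsilon>) / core \<delta> \<epsilon> 0"

lemma has_lead_core: "has_lead m (core \<delta> \<epsilon> m)"
proof -
  have "has_lead (int \<delta> * 0 + int \<epsilon> * 0 + m * 1) (core \<delta> \<epsilon> m)"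
    unfolding core_def
    by (intro has_lead_mult has_lead_power has_lead_powi has_lead_E4 has_lead_E6 has_lead_Delta)
  thus ?thesis by simp
qed

lemma core_nonzero [simp]: "core \<delta> \<epsilon> m \<noteq> 0"
  by (simp add: core_def)

lemma core_add: "core \<delta> \<epsilon> (m + n) = core \<delta> \<epsilon> m * Delta powi n"
  by (simp add: core_def power_int_add)

lemma E2_core: "E2 * core (next4 \<delta>) (1 - \<epsilon>) (m + shift \<delta> \<epsilon>) = core \<delta> \<epsilon> m * phi \<delta> \<epsilon>"
  using core_add[of \<delta> \<epsilon> 0 m] core_add[of "next4 \<delta>" "1 - \<epsilon>" "shift \<delta> \<epsilon>" m]
  by (simp add: phi_def add.commute)

text \<open>Every \<open>phi\<close> is \<open>E2 * E4 / E6\<close> up to a rational function of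
  \<open>klein_j\<close>, so the irrationality carries over.\<close>

lemma phi_eq:
  assumes "\<delta> \<in> {0, 1, 2}" and "\<epsilon> \<in> {0, 1}"
  shows "phi \<delta> \<epsilon> * E6 * (if \<delta> = 2 then klein_j else 1) = E2 * E4 * (if \<epsilon> = 0 then klein_j - 1728 else 1)"
proof -
  note defs = phi_def core_def next4_def shift_def
  have eqs: "klein_j = E4 ^ 3 / Delta" "klein_j - 1728 = E6 ^ 2 / Delta"
    using klein_j_Delta klein_j_minus_1728 by (simp_all add: nonzero_eq_divide_eq)
  show ?thesis
    using assms by (auto simp: defs eqs(2)) (auto simp: eqs(1) power2_eq_square power3_eq_cube
        power_int_minus divide_simps)
qed

lemma phi_irrational:
  assumes "\<delta> \<in> {0, 1, 2}" and "\<epsilon> \<in> {0, 1}" and "at_j a * phi \<delta> \<epsilon> = at_j b"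
  shows "a = 0" and "b = 0"
proof -
  define X Y where "X = (if \<delta> = 2 then [:0, 1:] else 1 :: complex poly)"
    and "Y = (if \<epsilon> = 0 then [:- 1728, 1:] else 1 :: complex poly)"
  have "phi \<delta> \<epsilon> * E6 * at_j X = E2 * E4 * at_j Y"
    using phi_eq[OF assms(1,2)] by (auto simp: X_def Y_def)
  hence "at_j (a * Y) * (E2 * E4) = at_j (b * X) * E6"
    unfolding at_j_mult assms(3)[symmetric] by algebra
  from E2_irrational[OF this] show "a = 0" "b = 0"
    by (auto simp: X_def Y_def split: if_splits)
qed

section \<open>Closure properties and modular building blocks\<close>

lemma quasimodular_add: "f \<in> quasimodular w s \<Longrightarrow> g \<in> quasimodular w s \<Longrightarrow> f + g \<in> quasimodular w s"
  and quasimodular_scale: "f \<in> quasimodular w s \<Longrightarrow> fls_const c * f \<in> quasimodular w s"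
  and quasimodular_0: "0 \<in> quasimodular w s"
  unfolding quasimodular_def by (rule fls_vs.span_add fls_vs.span_scale fls_vs.span_zero; assumption?)+

lemma quasimodular_generator:
  "a \<le> s \<Longrightarrow> 2 * int a + 4 * int b + 6 * int c = w \<Longrightarrow> E2 ^ a * E4 ^ b * E6 ^ c \<in> quasimodular w s"
  unfolding quasimodular_def by (rule fls_vs.span_base) blast

lemma quasimodular_induct [consumes 1, case_names generator add scale zero]:
  assumes "f \<in> quasimodular w s"
    and "\<And>a b c. a \<le> s \<Longrightarrow> 2 * int a + 4 * int b + 6 * int c = w \<Longrightarrow> P (E2 ^ a * E4 ^ b * E6 ^ c)"
    and "\<And>f g. P f \<Longrightarrow> P g \<Longrightarrow> P (f + g)" and "\<And>c f. P f \<Longrightarrow> P (fls_const c * f)" and "P 0"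
  shows "P f"
  using assms(1) unfolding quasimodular_def
  by (rule fls_vs.span_induct) (auto simp: fls_vs.subspace_def intro: assms(2-5))

lemma quasimodular_mult:
  assumes "f \<in> quasimodular w s" and "g \<in> quasimodular u 0"
  shows "f * g \<in> quasimodular (w + u) s"
  using assms(1)
proof (induction rule: quasimodular_induct)
  case (generator a b c)
  show ?case
    using assms(2)
  proof (induction rule: quasimodular_induct)
    case (generator a' b' c')
    have "E2 ^ a * E4 ^ (b + b') * E6 ^ (c + c') \<in> quasimodular (w + u) s"
      by (rule quasimodular_generator) (use generator \<open>a \<le> s\<close> \<open>2 * int a + 4 * int b + 6 * int c = w\<close> in auto)
    thus ?case using generator by (simp add: power_add algebra_simps)
  next
    case (scale c f)
    thus ?case using quasimodular_scale[OF scale, of c] by (simp add: mult.left_commute)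
  qed (simp_all add: distrib_left quasimodular_add quasimodular_0)
next
  case (scale c f)
  thus ?case using quasimodular_scale[OF scale, of c] by (simp add: mult.assoc)
qed (simp_all add: distrib_right quasimodular_add quasimodular_0)

lemma modular_E4: "E4 \<in> quasimodular 4 0" and modular_E6: "E6 \<in> quasimodular 6 0"
  and modular_1: "1 \<in> quasimodular 0 0" and modular_Delta: "Delta \<in> quasimodular 12 0"
proof -
  show "E4 \<in> quasimodular 4 0" "E6 \<in> quasimodular 6 0" "1 \<in> quasimodular 0 0"
    using quasimodular_generator[of 0 0 1 0 4] quasimodular_generator[of 0 0 0 1 6]
      quasimodular_generator[of 0 0 0 0 0] by simp_all
  have "E4 ^ 3 \<in> quasimodular 12 0" "E6 ^ 2 \<in> quasimodular 12 0"
    using quasimodular_generator[of 0 0 3 0 12] quasimodular_generator[of 0 0 0 2 12] by simp_all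
  hence "fls_const (1 / 1728) * (E4 ^ 3 + fls_const (- 1) * E6 ^ 2) \<in> quasimodular 12 0"
    by (intro quasimodular_scale quasimodular_add)
  moreover have "Delta = fls_const (1 / 1728) * (E4 ^ 3 + fls_const (- 1) * E6 ^ 2)"
  proof -
    have "fls_const (1 / 1728) * 1728 = (1 :: complex fls)"
      by (simp flip: fls_const_numeral)
    moreover have "E4 ^ 3 + fls_const (- 1) * E6 ^ 2 = 1728 * Delta" by (simp add: Delta_eq)
    ultimately show ?thesis by (simp flip: mult.assoc)
  qed
  ultimately show "Delta \<in> quasimodular 12 0" by simp
qed

lemma modular_power: "f \<in> quasimodular w 0 \<Longrightarrow> f ^ n \<in> quasimodular (int n * w) 0"
proof (induction n)
  case (Suc n)
  thus ?case using quasimodular_mult[of f w 0 "f ^ n" "int n * w"] by (simp add: algebra_simps)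
qed (simp add: modular_1)

lemma modular_core_klein_j:
  assumes "int i \<le> m"
  shows "core \<delta> \<epsilon> m * klein_j ^ i \<in> quasimodular (12 * m + 4 * int \<delta> + 6 * int \<epsilon>) 0"
proof -
  define n where "n = nat m - i"
  have "m = int i + int n" using assms by (simp add: n_def)
  hence "core \<delta> \<epsilon> m * klein_j ^ i = E4 ^ \<delta> * E6 ^ \<epsilon> * (klein_j * Delta) ^ i * Delta ^ n"
    by (simp add: core_def power_int_add power_mult_distrib)
  also have "\<dots> = E4 ^ \<delta> * E6 ^ \<epsilon> * (E4 ^ 3) ^ i * Delta ^ n"
    by (simp only: klein_j_Delta)
  also have "\<dots> \<in> quasimodular (int \<delta> * 4 + int \<epsilon> * 6 + int i * (int 3 * 4) + int n * 12) 0"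
    by (rule quasimodular_mult modular_power modular_E4 modular_E6 modular_Delta)+
  also have "int \<delta> * 4 + int \<epsilon> * 6 + int i * (int 3 * 4) + int n * 12 = 12 * m + 4 * int \<delta> + 6 * int \<epsilon>"
    using \<open>m = int i + int n\<close> by simp
  finally show ?thesis .
qed

text \<open>The weight fixes b modulo 3 and c modulo 2. The remaining powers of E4^3 and E6^2 are
  powers of \<open>Delta\<close> times j and j - 1728.\<close>

lemma modular_monomial:
  assumes "\<delta> \<in> {0, 1, 2}" and "\<epsilon> \<in> {0, 1}" and "4 * int b + 6 * int c = 12 * m + 4 * int \<delta> + 6 * int \<epsilon>"
  obtains p where "int (degree p) \<le> m" and "E4 ^ b * E6 ^ c = core \<delta> \<epsilon> m * at_j p"
proof -
  define x y where "x = b div 3" and "y = c div 2"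
  have xy: "b = \<delta> + 3 * x" "c = \<epsilon> + 2 * y" "m = int x + int y"
  proof -
    define r t where "r = b mod 3" and "t = c mod 2"
    have bc: "b = r + 3 * x" "c = t + 2 * y" by (simp_all add: r_def t_def x_def y_def)
    have "r < 3" "t < 2" by (simp_all add: r_def t_def)
    hence "r \<in> {0, 1, 2}" "t \<in> {0, 1}" by auto
    moreover define z where "z = int x + int y - m"
    moreover have "2 * int r + 3 * int t + 6 * z = 2 * int \<delta> + 3 * int \<epsilon>"
      using assms(3) unfolding bc z_def by simp
    ultimately have "r = \<delta> \<and> t = \<epsilon> \<and> z = 0"
      using assms(1,2) by (elim insertE emptyE; simp; presburger)
    hence "r = \<delta> \<and> t = \<epsilon> \<and> m = int x + int y"
      by (simp add: z_def)
    thus "b = \<delta> + 3 * x" "c = \<epsilon> + 2 * y" "m = int x + int y"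
      using bc by auto
  qed
  define p :: "complex poly" where "p = [:0, 1:] ^ x * [:- 1728, 1:] ^ y"
  have at_j_power: "at_j (q ^ n) = at_j q ^ n" for q n by (induction n) simp_all
  show ?thesis
  proof (rule that[of p])
    show "int (degree p) \<le> m"
      unfolding p_def by (simp add: xy degree_mult_eq degree_linear_power degree_power_eq)
    have "E4 ^ b * E6 ^ c = E4 ^ \<delta> * E6 ^ \<epsilon> * (E4 ^ 3) ^ x * (E6 ^ 2) ^ y"
      by (simp add: xy power_add power_mult)
    also have "\<dots> = core \<delta> \<epsilon> m * at_j p"
      unfolding klein_j_Delta[symmetric] klein_j_minus_1728[symmetric]
      by (simp add: p_def at_j_power core_def xy power_int_add power_mult_distrib)
    finally show "E4 ^ b * E6 ^ c = core \<delta> \<epsilon> m * at_j p" .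
  qed
qed

text \<open>Depth one needs a nonzero modular form of weight w - 2 to multiply \<open>E2\<close>,
  and \<open>m + shift \<delta> \<epsilon>\<close> is the exponent of \<open>Delta\<close> in the
  core of that weight.\<close>

lemma depth1_weight_iff:
  assumes "\<delta> \<in> {0, 1, 2}" and "\<epsilon> \<in> {0, 1}"
  shows "depth1_weight (12 * m + 4 * int \<delta> + 6 * int \<epsilon>) \<longleftrightarrow> m + shift \<delta> \<epsilon> \<ge> 0"
  using assms unfolding depth1_weight_def shift_def by (elim insertE emptyE; simp; presburger)

lemma weight_E2_core:
  assumes "\<delta> \<in> {0, 1, 2}" and "\<epsilon> \<in> {0, 1}"
  shows "12 * (m + shift \<delta> \<epsilon>) + 4 * int (next4 \<delta>) + 6 * int (1 - \<epsilon>) =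
         12 * m + 4 * int \<delta> + 6 * int \<epsilon> - 2"
  using assms unfolding shift_def next4_def by auto

text \<open>The alternative \<open>q = 0\<close> serves m = - 1, which under the hypotheses occurs
  only in weight 2, where no nonzero modular form exists.\<close>

lemma quasimodular_form:
  assumes "\<delta> \<in> {0, 1, 2}" and "\<epsilon> \<in> {0, 1}" and "m + shift \<delta> \<epsilon> \<ge> 0"
    and "f \<in> quasimodular (12 * m + 4 * int \<delta> + 6 * int \<epsilon>) 1"
  obtains p q where "degree p < nat (m + shift \<delta> \<epsilon> + 1)" and "q = 0 \<or> degree q < nat (m + 1)"
    and "f = core \<delta> \<epsilon> m * (at_j p * phi \<delta> \<epsilon> + at_j q)"
proof -
  let ?P = "\<lambda>f. \<exists>p q. degree p < nat (m + shift \<delta> \<epsilon> + 1) \<and> (q = 0 \<or> degree q < nat (m + 1)) \<and>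
    f = core \<delta> \<epsilon> m * (at_j p * phi \<delta> \<epsilon> + at_j q)"
  have "?P f"
    using assms(4)
  proof (induction rule: quasimodular_induct)
    case (generator a b c)
    consider "a = 0" | "a = 1" using generator by linarith
    thus ?case
    proof cases
      case 1
      then obtain p where p: "int (degree p) \<le> m" "E4 ^ b * E6 ^ c = core \<delta> \<epsilon> m * at_j p"
        using generator modular_monomial[OF assms(1,2), of b c m] by auto
      show ?thesis
        by (rule exI[of _ 0], rule exI[of _ p]) (use 1 p assms(3) in auto)
    next
      case 2
      have "next4 \<delta> \<in> {0, 1, 2}" "1 - \<epsilon> \<in> {0, 1}" using assms by (auto simp: next4_def)
      moreover have "4 * int b + 6 * int c =
          12 * (m + shift \<delta> \<epsilon>) + 4 * int (next4 \<delta>) + 6 * int (1 - \<epsilon>)"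
        using generator 2 weight_E2_core[OF assms(1,2)] by simp
      ultimately obtain p where p: "int (degree p) \<le> m + shift \<delta> \<epsilon>"
          "E4 ^ b * E6 ^ c = core (next4 \<delta>) (1 - \<epsilon>) (m + shift \<delta> \<epsilon>) * at_j p"
        by (rule modular_monomial)
      have "E2 ^ a * E4 ^ b * E6 ^ c = core \<delta> \<epsilon> m * phi \<delta> \<epsilon> * at_j p"
        unfolding E2_core[symmetric] using 2 p(2) by (simp add: mult.assoc)
      thus ?thesis
        by (intro exI[of _ p] exI[of _ 0]) (use p(1) in \<open>auto simp: algebra_simps\<close>)
    qed
  next
    case (add f g)
    then obtain p q p' q' where *: "degree p < nat (m + shift \<delta> \<epsilon> + 1)" "q = 0 \<or> degree q < nat (m + 1)"
      "f = core \<delta> \<epsilon> m * (at_j p * phi \<delta> \<epsilon> + at_j q)"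
      "degree p' < nat (m + shift \<delta> \<epsilon> + 1)" "q' = 0 \<or> degree q' < nat (m + 1)"
      "g = core \<delta> \<epsilon> m * (at_j p' * phi \<delta> \<epsilon> + at_j q')"
      by blast
    have "q + q' = 0 \<or> degree (q + q') < nat (m + 1)"
      using *(2,5) degree_add_less[of q "nat (m + 1)" q'] by auto
    thus ?case
      using * by (intro exI[of _ "p + p'"] exI[of _ "q + q'"]) (auto simp: degree_add_less algebra_simps)
  next
    case (scale c f)
    then obtain p q where *: "degree p < nat (m + shift \<delta> \<epsilon> + 1)" "q = 0 \<or> degree q < nat (m + 1)"
      "f = core \<delta> \<epsilon> m * (at_j p * phi \<delta> \<epsilon> + at_j q)"
      by blast
    thus ?case
      by (intro exI[of _ "smult c p"] exI[of _ "smult c q"])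
         (auto simp: algebra_simps intro: le_less_trans[OF degree_smult_le])
  next
    case zero
    show ?case by (rule exI[of _ 0], rule exI[of _ 0]) (use assms(3) in auto)
  qed
  thus ?thesis using that by blast
qed

lemma poly_of_coeffs:
  assumes "p = 0 \<or> degree p < n"
  shows "p = (\<Sum>i<n. monom (coeff p i) i)"
  using assms by (intro poly_eqI) (auto simp: coeff_sum coeff_eq_0 if_distrib cong: if_cong)

text \<open>The products of \<open>core \<delta> \<epsilon> m\<close> with powers of
  \<open>klein_j\<close>, with and without \<open>phi\<close>, form a basis; irrationality of
  \<open>phi\<close> gives both independence and disjointness of the two families.\<close>

lemma dim_quasimodular_1:
  assumes "\<delta> \<in> {0, 1, 2}" and "\<epsilon> \<in> {0, 1}" and "m + shift \<delta> \<epsilon> \<ge> 0"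
  shows "fls_vs.dim (quasimodular (12 * m + 4 * int \<delta> + 6 * int \<epsilon>) 1) = nat (m + shift \<delta> \<epsilon> + 1) + nat (m + 1)"
proof -
  define w where "w = 12 * m + 4 * int \<delta> + 6 * int \<epsilon>"
  define n1 n0 where "n1 = nat (m + shift \<delta> \<epsilon> + 1)" and "n0 = nat (m + 1)"
  define C where "C = core \<delta> \<epsilon> m"
  define a b where "a = (\<lambda>i. C * phi \<delta> \<epsilon> * klein_j ^ i)" and "b = (\<lambda>i. C * klein_j ^ i)"
  have "C \<noteq> 0" by (simp add: C_def)
  have "phi \<delta> \<epsilon> \<noteq> 0" by (simp add: phi_def)
  have monom: "klein_j ^ i = at_j (monom 1 i)" for i by simp
  have inj_j: "klein_j ^ i = klein_j ^ k \<longleftrightarrow> i = k" for i k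
  proof
    assume "klein_j ^ i = klein_j ^ k"
    hence "at_j (monom 1 i - monom 1 k) = 0" by simp
    hence "degree (monom (1 :: complex) i) = degree (monom (1 :: complex) k)"
      unfolding at_j_eq_0_iff by simp
    thus "i = k" by (simp add: degree_monom_eq)
  qed simp
  have inj: "inj_on a {..<n1}" "inj_on b {..<n0}"
    using \<open>C \<noteq> 0\<close> \<open>phi \<delta> \<epsilon> \<noteq> 0\<close> by (auto simp: inj_on_def a_def b_def inj_j)
  have disj: "a ` {..<n1} \<inter> b ` {..<n0} = {}"
  proof -
    have "a i \<noteq> b k" for i k
    proof
      assume "a i = b k"
      hence "at_j (monom 1 i) * phi \<delta> \<epsilon> = at_j (monom 1 k)"
        using \<open>C \<noteq> 0\<close> by (simp add: a_def b_def mult.commute)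
      from phi_irrational(1)[OF assms(1,2) this] show False by simp
    qed
    thus ?thesis by auto
  qed
  have "fls_vs.independent (a ` {..<n1} \<union> b ` {..<n0})"
  proof (rule fls_vs.independent_if_scalars_zero)
    fix f x assume sum: "(\<Sum>x\<in>a ` {..<n1} \<union> b ` {..<n0}. fls_const (f x) * x) = 0"
      and x: "x \<in> a ` {..<n1} \<union> b ` {..<n0}"
    define p q where "p = (\<Sum>i<n1. monom (f (a i)) i)" and "q = (\<Sum>i<n0. monom (f (b i)) i)"
    have "C * (at_j p * phi \<delta> \<epsilon> + at_j q) = 0"
      using sum unfolding sum.union_disjoint[OF finite_imageI finite_imageI disj, OF finite_lessThan finite_lessThan]
        sum.reindex[OF inj(1)] sum.reindex[OF inj(2)]
      by (simp add: p_def q_def at_j_sum a_def b_def sum_distrib_left sum_distrib_right algebra_simps)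
    hence "at_j p * phi \<delta> \<epsilon> = at_j (- q)" using \<open>C \<noteq> 0\<close> by (simp add: eq_neg_iff_add_eq_0)
    from phi_irrational[OF assms(1,2) this] have "p = 0" "q = 0" by simp_all
    moreover have "coeff p i = f (a i)" if "i < n1" for i
      using that by (simp add: p_def coeff_sum if_distrib cong: if_cong)
    moreover have "coeff q i = f (b i)" if "i < n0" for i
      using that by (simp add: q_def coeff_sum if_distrib cong: if_cong)
    ultimately show "f x = 0" using x by force
  qed auto
  moreover have "fls_vs.span (a ` {..<n1} \<union> b ` {..<n0}) = quasimodular w 1"
  proof
    have "a i \<in> quasimodular w 1" if "i < n1" for i
    proof -
      have "E2 \<in> quasimodular 2 1" using quasimodular_generator[of 1 1 0 0 2] by simp
      moreover have "core (next4 \<delta>) (1 - \<epsilon>) (m + shift \<delta> \<epsilon>) * klein_j ^ i \<in> quasimodular (w - 2) 0"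
        using modular_core_klein_j[of i "m + shift \<delta> \<epsilon>" "next4 \<delta>" "1 - \<epsilon>"] that
        unfolding weight_E2_core[OF assms(1,2)] by (simp add: w_def n1_def)
      ultimately have "E2 * (core (next4 \<delta>) (1 - \<epsilon>) (m + shift \<delta> \<epsilon>) * klein_j ^ i) \<in> quasimodular (2 + (w - 2)) 1"
        by (rule quasimodular_mult)
      moreover have "a i = E2 * (core (next4 \<delta>) (1 - \<epsilon>) (m + shift \<delta> \<epsilon>) * klein_j ^ i)"
        by (simp only: a_def C_def E2_core[symmetric] mult.assoc)
      ultimately show ?thesis by simp
    qed
    moreover have "b i \<in> quasimodular w 1" if "i < n0" for i
    proof -
      have "b i \<in> quasimodular w 0"
        using modular_core_klein_j[of i m \<delta> \<epsilon>] that by (simp add: b_def C_def w_def n0_def)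
      moreover have "1 \<in> quasimodular 0 1" using quasimodular_generator[of 0 1 0 0 0] by simp
      ultimately show ?thesis using quasimodular_mult[of 1 0 1 "b i" w] by simp
    qed
    ultimately have "a ` {..<n1} \<union> b ` {..<n0} \<subseteq> quasimodular w 1" by auto
    thus "fls_vs.span (a ` {..<n1} \<union> b ` {..<n0}) \<subseteq> quasimodular w 1"
      unfolding quasimodular_def by (rule fls_vs.span_minimal) (rule fls_vs.subspace_span)
  next
    show "quasimodular w 1 \<subseteq> fls_vs.span (a ` {..<n1} \<union> b ` {..<n0})"
    proof
      fix f assume "f \<in> quasimodular w 1"
      then obtain p q where pq: "degree p < n1" "q = 0 \<or> degree q < n0"
          "f = C * (at_j p * phi \<delta> \<epsilon> + at_j q)"
        using quasimodular_form[OF assms] unfolding w_def n1_def n0_def C_def by metis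
      have "at_j p = (\<Sum>i<n1. fls_const (coeff p i) * klein_j ^ i)"
        using poly_of_coeffs[of p n1] pq(1) at_j_sum[of "\<lambda>i. monom (coeff p i) i" "{..<n1}"] by simp
      moreover have "at_j q = (\<Sum>i<n0. fls_const (coeff q i) * klein_j ^ i)"
        using poly_of_coeffs[of q n0] pq(2) at_j_sum[of "\<lambda>i. monom (coeff q i) i" "{..<n0}"] by simp
      ultimately have "f = (\<Sum>i<n1. fls_const (coeff p i) * a i) + (\<Sum>i<n0. fls_const (coeff q i) * b i)"
        unfolding pq(3) a_def b_def by (simp add: sum_distrib_left sum_distrib_right algebra_simps)
      thus "f \<in> fls_vs.span (a ` {..<n1} \<union> b ` {..<n0})"
        by (simp only:) (intro fls_vs.span_add fls_vs.span_sum fls_vs.span_scale; rule fls_vs.span_base; blast)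
    qed
  qed
  moreover have "card (a ` {..<n1} \<union> b ` {..<n0}) = n1 + n0"
    using inj disj by (simp add: card_Un_disjoint card_image)
  ultimately have "fls_vs.dim (quasimodular w 1) = n1 + n0"
    using fls_vs.dim_span_eq_card_independent by metis
  thus ?thesis by (simp add: w_def n1_def n0_def)
qed

text \<open>The extremal order is 2 m + shift + 1, and the core accounts for m of it. The quotient
  thus vanishes to one order more than the degree bound for \<open>p\<close>, as an error of Pade
  approximation should.\<close>

lemma normalized_extremal_form:
  assumes "\<delta> \<in> {0, 1, 2}" and "\<epsilon> \<in> {0, 1}" and "m + shift \<delta> \<epsilon> \<ge> 0"
    and "normalized_extremal (12 * m + 4 * int \<delta> + 6 * int \<epsilon>) f"
  obtains p q where "degree p \<le> nat (m + shift \<delta> \<epsilon>)" "f / core \<delta> \<epsilon> m = at_j p * phi \<delta> \<epsilon> + at_j q"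
    and "has_lead (m + shift \<delta> \<epsilon> + 1) (f / core \<delta> \<epsilon> m)"
proof -
  have "m \<ge> - 1" using assms(3) by (auto simp: shift_def split: if_splits)
  hence d: "int (fls_vs.dim (quasimodular (12 * m + 4 * int \<delta> + 6 * int \<epsilon>) 1)) - 1 = m + (m + shift \<delta> \<epsilon> + 1)"
    using assms(3) unfolding dim_quasimodular_1[OF assms(1-3)] by simp
  have "has_lead (m + (m + shift \<delta> \<epsilon> + 1)) f"
    by (rule has_leadI) (use assms(4)[unfolded normalized_extremal_def Let_def d] in blast)+
  from has_lead_divide[OF this has_lead_core[of m \<delta> \<epsilon>]]
  have "has_lead (m + shift \<delta> \<epsilon> + 1) (f / core \<delta> \<epsilon> m)" by (simp add: add.assoc)
  moreover have "f \<in> quasimodular (12 * m + 4 * int \<delta> + 6 * int \<epsilon>) 1"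
    using assms(4) by (simp only: normalized_extremal_def)
  from quasimodular_form[OF assms(1-3) this] obtain p q where "degree p < nat (m + shift \<delta> \<epsilon> + 1)"
      "f = core \<delta> \<epsilon> m * (at_j p * phi \<delta> \<epsilon> + at_j q)"
    by metis
  ultimately show ?thesis using assms(3) by (intro that[of p q]) auto
qed

section \<open>Pade approximation in the modular invariant\<close>

lemma fls_mult_order:
  fixes f g :: "complex fls"
  assumes "\<And>i. i < m \<Longrightarrow> fls_nth f i = 0" and "\<And>i. i < n \<Longrightarrow> fls_nth g i = 0"
  shows "i < m + n \<Longrightarrow> fls_nth (f * g) i = 0" and "fls_nth (f * g) (m + n) = fls_nth f m * fls_nth g n"
proof -
  have "(\<forall>i < m + n. fls_nth (f * g) i = 0) \<and> fls_nth (f * g) (m + n) = fls_nth f m * fls_nth g n"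
  proof (cases "f = 0 \<or> g = 0")
    case False
    hence sub: "fls_subdegree f \<ge> m" "fls_subdegree g \<ge> n"
      using assms by (auto intro!: fls_subdegree_geI)
    consider "fls_subdegree f = m" "fls_subdegree g = n" | "m + n < fls_subdegree f + fls_subdegree g"
      using sub by linarith
    thus ?thesis
    proof cases
      case 1
      thus ?thesis using fls_times_base[of f g] by (auto intro!: fls_times_nth_eq0)
    next
      case 2
      hence "fls_nth f m = 0 \<or> fls_nth g n = 0" using sub by (cases "fls_subdegree f = m") auto
      thus ?thesis using 2 by (auto intro!: fls_times_nth_eq0)
    qed
  qed auto
  thus "i < m + n \<Longrightarrow> fls_nth (f * g) i = 0" "fls_nth (f * g) (m + n) = fls_nth f m * fls_nth g n"
    by auto
qed

text \<open>Each j^i dj is the differential of j^(i+1) / (i+1), and derivatives have no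
  residue.\<close>

lemma residue_at_j: "fls_nth (at_j p * fls_deriv klein_j) (- 1) = 0"
proof -
  have monom: "fls_nth (klein_j ^ i * fls_deriv klein_j) (- 1) = 0" for i
  proof -
    have "fls_deriv (klein_j ^ Suc i) = fls_const (of_nat (Suc i)) * (klein_j ^ i * fls_deriv klein_j)"
      by (subst fls_deriv_power) (simp add: fls_of_nat algebra_simps)
    from arg_cong[OF this, of "\<lambda>f. fls_nth f (- 1)"]
    have "of_nat (Suc i) * fls_nth (klein_j ^ i * fls_deriv klein_j) (- 1) = 0"
      by (simp only: fls_deriv_residue fls_mult_const_nth)
    thus ?thesis by (simp del: of_nat_Suc)
  qed
  have "at_j p = (\<Sum>i\<le>degree p. fls_const (coeff p i) * klein_j ^ i)"
    using poly_as_sum_of_monoms[of p] at_j_sum[of "\<lambda>i. monom (coeff p i) i" "{..degree p}"] by simp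
  thus ?thesis by (simp add: sum_distrib_right fls_nth_sum mult.assoc monom)
qed

text \<open>
  With \<open>u = 1 / j\<close> as uniformizer, \<open>pairing p f\<close> is the coefficient of \<open>u\<close> in \<open>p(j) f\<close>,
  i.e. minus the residue at the cusp of \<open>p(j) f dj\<close>.
\<close>

definition pairing :: "complex poly \<Rightarrow> complex fls \<Rightarrow> complex" where
  "pairing p f = - fls_nth (at_j p * f * fls_deriv klein_j) (- 1)"

lemma pairing_add: "pairing (p + q) f = pairing p f + pairing q f"
  and pairing_smult: "pairing (smult c p) f = c * pairing p f"
  and pairing_scale: "pairing p (fls_const c * f) = c * pairing p f"
  and pairing_0 [simp]: "pairing 0 f = 0"
  by (simp_all add: pairing_def distrib_right mult.assoc mult.left_commute[of "at_j p" "fls_const c"])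

lemma pairing_sum: "pairing (sum p S) f = (\<Sum>x\<in>S. pairing (p x) f)"
  by (induction S rule: infinite_finite_induct) (simp_all add: pairing_add)

text \<open>The polynomial parts contribute no residue, so both sides are minus the residue of p(j)
  q(j) \<phi> dj.\<close>

lemma pairing_swap: "pairing p (at_j q * \<phi> + at_j b) = pairing q (at_j p * \<phi> + at_j c)"
proof -
  have "pairing p (at_j q * \<phi> + at_j b) = - fls_nth (at_j p * at_j q * \<phi> * fls_deriv klein_j) (- 1)" for p q b
    using residue_at_j[of "p * b"] by (simp add: pairing_def algebra_simps)
  thus ?thesis by (simp only: mult.commute[of "at_j p" "at_j q"])
qed

text \<open>Orders - n, n + 1 and - 2 add up to - 1, so only the leading terms meet in the residue.
  The leading coefficient - 1 of the derivative of \<open>klein_j\<close> absorbs the sign in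
  \<open>pairing\<close>.\<close>

lemma pairing_low_degree:
  assumes "\<And>i. i \<le> int n \<Longrightarrow> fls_nth f i = 0" and "degree p \<le> n"
  shows "pairing p f = coeff p n * fls_nth f (int n + 1)"
proof -
  have j: "i < - 2 \<Longrightarrow> fls_nth (fls_deriv klein_j) i = 0" "fls_nth (fls_deriv klein_j) (- 2) = - 1" for i
    using has_lead_klein_j has_lead_below[OF has_lead_klein_j, of "i + 1"] by (auto simp: has_lead_def)
  have pf: "i < - int n + (int n + 1) \<Longrightarrow> fls_nth (at_j p * f) i = 0"
    "fls_nth (at_j p * f) (- int n + (int n + 1)) = coeff p n * fls_nth f (int n + 1)" for i
    using fls_mult_order[of "- int n" "at_j p" "int n + 1" f] at_j_order[OF assms(2)] assms(1) by auto
  have "fls_nth (at_j p * f * fls_deriv klein_j) (1 + - 2) = fls_nth (at_j p * f) 1 * fls_nth (fls_deriv klein_j) (- 2)"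
    by (rule fls_mult_order(2)) (use pf j in auto)
  thus ?thesis using pf(2) j(2) by (simp add: pairing_def)
qed

text \<open>Here \<open>a i\<close> are the denominators and \<open>g i\<close> the scaled errors.
  For \<open>a i\<close> only an upper bound on the degree is asked, since no more is known of the
  Atkin-like polynomials at the outset.\<close>

locale pade_family =
  fixes \<phi> :: "complex fls" and I :: "'i set" and e :: "'i \<Rightarrow> nat" and a b :: "'i \<Rightarrow> complex poly"
    and \<kappa> :: "'i \<Rightarrow> complex" and g :: "'i \<Rightarrow> complex fls"
  assumes form: "i \<in> I \<Longrightarrow> g i = fls_const (\<kappa> i) * (at_j (a i) * \<phi> + at_j (b i))"
    and lead: "i \<in> I \<Longrightarrow> has_lead (int (e i) + 1) (g i)"
    and degree_le: "i \<in> I \<Longrightarrow> degree (a i) \<le> e i"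
    and inj: "inj_on e I"
begin

lemma scale_nonzero: "i \<in> I \<Longrightarrow> \<kappa> i \<noteq> 0"
  using form lead has_lead_nonzero by fastforce

lemma pairing_diag:
  assumes "i \<in> I" and "degree p \<le> e i"
  shows "pairing p (g i) = coeff p (e i)"
  using pairing_low_degree[of "e i" "g i" p] has_lead_below[OF lead[OF assms(1)]] lead[OF assms(1)] assms(2)
  by (simp add: has_lead_def)

lemma pairing_scaled_swap:
  assumes "i \<in> I"
  shows "pairing p (g i) = \<kappa> i * pairing (a i) (at_j p * \<phi> + at_j c)"
  unfolding form[OF assms] pairing_scale using pairing_swap[of p "a i" \<phi> "b i" c] by simp

text \<open>For \<open>e k < e i\<close> the error vanishes to too high an order; the opposite case
  follows by exchanging the roles of the two denominators.\<close>

lemma orthogonal: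
  assumes "i \<in> I" and "k \<in> I" and "i \<noteq> k"
  shows "pairing (a k) (g i) = 0"
proof -
  have less: "pairing (a k) (g i) = 0" if "i \<in> I" "k \<in> I" "e k < e i" for i k
    using pairing_diag[OF that(1), of "a k"] degree_le[OF that(2)] that(3) by (simp add: coeff_eq_0)
  have "e i \<noteq> e k" using assms inj by (auto dest: inj_onD)
  then consider "e k < e i" | "e i < e k" by linarith
  thus ?thesis
  proof cases
    case 2
    have "pairing (a i) (at_j (a k) * \<phi> + at_j (b k)) = 0"
      using less[OF assms(2,1) 2] scale_nonzero[OF assms(2)] unfolding form[OF assms(2)] pairing_scale by simp
    thus ?thesis using pairing_scaled_swap[OF assms(1), of "a k" "b k"] by simp
  qed (use assms less in auto)
qed

text \<open>If r were nonzero, pairing it with the error of index deg r would give its leading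
  coefficient. After a swap the same value is a multiple of the pairing of a denominator with r(j)
  \<phi> + s(j), which vanishes to too high an order.\<close>

lemma pade_unique:
  assumes surj: "\<And>n. \<exists>i\<in>I. e i = n"
    and "degree r \<le> n" and zero: "\<And>i. i \<le> int n + 1 \<Longrightarrow> fls_nth (at_j r * \<phi> + at_j s) i = 0"
  shows "at_j r * \<phi> + at_j s = 0"
proof -
  have "r = 0"
  proof (rule ccontr)
    assume "r \<noteq> 0"
    obtain i where i: "i \<in> I" "e i = degree r" using surj by blast
    have "pairing (a i) (at_j r * \<phi> + at_j s) = 0"
      using pairing_low_degree[of "n + 1" "at_j r * \<phi> + at_j s" "a i"] zero degree_le[OF i(1)] i(2) assms(2)
      by (simp add: coeff_eq_0)
    hence "pairing r (g i) = 0" using pairing_scaled_swap[OF i(1), of r s] by simp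
    thus False using pairing_diag[OF i(1), of r] i(2) \<open>r \<noteq> 0\<close> by simp
  qed
  moreover have "lead_coeff s = 0"
    using zero[of "- int (degree s)"] at_j_order(2)[of s "degree s"] \<open>r = 0\<close> by simp
  ultimately show ?thesis by simp
qed

lemma coefficient_eq_pairing:
  assumes monic: "\<And>i. i \<in> I \<Longrightarrow> lead_coeff (a i) = 1"
    and P: "\<And>n. degree (P n) = n" "\<And>n. lead_coeff (P n) = 1"
    and S: "\<And>n. S n \<subseteq> I" "\<And>n. P n = (\<Sum>i\<in>S n. smult (c n i) (a i))"
    and c: "\<And>n i. i \<notin> S n \<Longrightarrow> c n i = 0" and i: "i \<in> I"
  shows "c n i = pairing (P n) (g i)"
proof -
  have expand: "pairing (P n) (g i) = c n i * pairing (a i) (g i)" for n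
  proof -
    \<comment> \<open>Over an infinite index set the sum would be 0 by convention, which is not
      monic.\<close>
    have "finite (S n)"
    proof (rule ccontr)
      assume "infinite (S n)"
      hence "P n = 0" using S(2)[of n] by simp
      thus False using P(2)[of n] by simp
    qed
    have "pairing (P n) (g i) = (\<Sum>k\<in>S n. c n k * pairing (a k) (g i))"
      by (subst S(2)) (simp add: pairing_sum pairing_smult)
    also have "\<dots> = (\<Sum>k\<in>S n. if k = i then c n i * pairing (a i) (g i) else 0)"
      by (rule sum.cong) (use orthogonal[OF i] S(1)[of n] in auto)
    also have "\<dots> = c n i * pairing (a i) (g i)"
      using \<open>finite (S n)\<close> c[of i n] by simp
    finally show ?thesis .
  qed
  \<comment> \<open>The expansion of \<open>P (e i)\<close> forces \<open>a i\<close> to have full degree.\<close>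
  have "pairing (P (e i)) (g i) = 1"
    using pairing_diag[OF i, of "P (e i)"] P[of "e i"] by simp
  hence "coeff (a i) (e i) \<noteq> 0"
    using expand[of "e i"] pairing_diag[OF i degree_le[OF i]] by auto
  hence "degree (a i) = e i" using degree_le[OF i] le_degree le_antisym by blast
  hence "pairing (a i) (g i) = 1"
    using pairing_diag[OF i degree_le[OF i]] monic[OF i] by simp
  thus ?thesis using expand by simp
qed

end

section \<open>Atkin-like and Faber polynomials\<close>

definition wt :: "nat \<Rightarrow> nat \<Rightarrow> int \<Rightarrow> int" where
  "wt \<delta> \<epsilon> r = 12 * r + 4 * int \<delta> + 6 * int \<epsilon>"

lemma extremal_quotient:
  assumes "extremal_family G" and "\<delta> \<in> {0, 1, 2}" and "\<epsilon> \<in> {0, 1}" and "r + shift \<delta> \<epsilon> \<ge> 0"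
  obtains p q where "degree p \<le> nat (r + shift \<delta> \<epsilon>)"
    and "G (wt \<delta> \<epsilon> r) / core \<delta> \<epsilon> r = at_j p * phi \<delta> \<epsilon> + at_j q"
    and "has_lead (r + shift \<delta> \<epsilon> + 1) (G (wt \<delta> \<epsilon> r) / core \<delta> \<epsilon> r)"
proof -
  have "normalized_extremal (12 * r + 4 * int \<delta> + 6 * int \<epsilon>) (G (wt \<delta> \<epsilon> r))"
    using assms depth1_weight_iff[OF assms(2,3), of r] by (auto simp: extremal_family_def wt_def)
  from normalized_extremal_form[OF assms(2-4) this] show ?thesis using that by metis
qed

lemma has_lead_scaled_nonzero: "has_lead n (fls_const c * f) \<Longrightarrow> c \<noteq> 0"
  using has_lead_nonzero by fastforce

text \<open>Weights 4 and 10 modulo 12 have no presentation of their own, so \<open>\<delta>\<close>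
  = 1 is absent here and is later reduced to \<open>\<delta>\<close> = 0.\<close>

lemma atkin_like_form:
  assumes "atkin_like G A B" and "\<delta> \<in> {0, 2}" and "\<epsilon> \<in> {0, 1}" and "r + shift \<delta> \<epsilon> \<ge> 0"
  obtains \<kappa> b where "lead_coeff (atkin_ext A r (4 * \<delta> + 6 * \<epsilon>)) = 1"
    and "G (wt \<delta> \<epsilon> r) / core \<delta> \<epsilon> r = fls_const \<kappa> * (at_j (atkin_ext A r (4 * \<delta> + 6 * \<epsilon>)) * phi \<delta> \<epsilon> + at_j b)"
proof -
  note defs = core_def phi_def next4_def shift_def wt_def atkin_ext_def
  note KK = assms(1)[unfolded atkin_like_def]
  consider "\<delta> = 0" "\<epsilon> = 0" | "\<delta> = 0" "\<epsilon> = 1" | "\<delta> = 2" "\<epsilon> = 0" | "\<delta> = 2" "\<epsilon> = 1"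
    using assms(2,3) by auto
  thus ?thesis
  proof cases
    case 1
    hence "r \<ge> 1" using assms(4) by (simp add: shift_def)
    define N where "N = inverse (norm0 (nat (2 * r)))"
    have "lead_coeff (A r 0) = 1" and G: "G (12 * r) = fls_const N *
        (- E2 * E4 * E6 * Delta powi (r - 1) * at_j (A r 0) + Delta powi r * at_j (B r 0))"
      using conjunct1[OF KK] \<open>r \<ge> 1\<close> by (auto simp: N_def)
    show ?thesis
      by (rule that[of "- N" "- B r 0"])
         (use 1 \<open>lead_coeff (A r 0) = 1\<close> in \<open>auto simp: defs G power_int_diff, simp add: field_simps\<close>)
  next
    case 2
    hence "r \<ge> 0" using assms(4) by (simp add: shift_def)
    define N where "N = inverse (norm0 (nat (2 * r + 1)))"
    have "lead_coeff (A r 6) = 1" and G: "G (12 * r + 6) = fls_const N *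
          (E2 * E4 * Delta powi r * at_j (A r 6) - E6 * Delta powi r * at_j (B r 6))"
      using conjunct1[OF conjunct2[OF conjunct2[OF KK]]] \<open>r \<ge> 0\<close> by (auto simp: N_def)
    show ?thesis
      by (rule that[of N "- B r 6"])
         (use 2 \<open>lead_coeff (A r 6) = 1\<close> in \<open>auto simp: defs G, simp add: field_simps\<close>)
  next
    case 3
    hence "r \<ge> 0" using assms(4) by (simp add: shift_def)
    define N where "N = inverse (norm2 (nat (2 * r + 1)))"
    have "lead_coeff (A r 8) = 1" and G: "G (12 * r + 8) = fls_const N *
          (- E2 * E6 * Delta powi r * at_j (A r 8) + E4 ^ 2 * Delta powi r * at_j (B r 8))"
      using conjunct2[OF conjunct2[OF conjunct2[OF KK]]] \<open>r \<ge> 0\<close> by (auto simp: N_def)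
    show ?thesis
      by (rule that[of "- N" "- B r 8"])
         (use 3 \<open>lead_coeff (A r 8) = 1\<close> in \<open>auto simp: defs G, simp add: field_simps\<close>)
  next
    case 4
    \<comment> \<open>The weight is 12 r + 14 = 12 (r + 1) + 2; the value r = - 1 is allowed and
      belongs to \<open>G 2\<close>.\<close>
    hence "r + 1 \<ge> 0" using assms(4) by (simp add: shift_def)
    define N where "N = inverse (norm2 (nat (2 * (r + 1))))"
    have "wt \<delta> \<epsilon> r = 12 * (r + 1) + 2" using 4 by (simp add: wt_def)
    moreover have "G (12 * (r + 1) + 2) = fls_const N * (E2 * Delta powi (r + 1) * at_j (A (r + 1) 2)
        - E4 ^ 2 * E6 * Delta powi (r + 1 - 1) * at_j (B (r + 1) 2))"
      and lc: "lead_coeff (A (r + 1) 2) = 1"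
      using conjunct1[OF conjunct2[OF KK]] \<open>r + 1 \<ge> 0\<close> by (auto simp: N_def)
    ultimately have G: "G (wt \<delta> \<epsilon> r) = fls_const N * (E2 * (Delta powi r * Delta) * at_j (A (r + 1) 2)
        - E4 ^ 2 * E6 * Delta powi r * at_j (B (r + 1) 2))"
      by (simp add: power_int_add)
    have "core \<delta> \<epsilon> r = E4 ^ 2 * E6 * Delta powi r" "phi \<delta> \<epsilon> = E2 * Delta / (E4 ^ 2 * E6)"
      "atkin_ext A r (4 * \<delta> + 6 * \<epsilon>) = A (r + 1) 2"
      using 4 by (simp_all add: core_def phi_def next4_def shift_def atkin_ext_def)
    with lc G show ?thesis
      by (intro that[of N "- B (r + 1) 2"]) (simp, simp add: field_simps)
  qed
qed

text \<open>Multiplication by \<open>E4\<close> leads from \<open>\<delta>\<close> = 0 to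
  \<open>\<delta>\<close> = 1 and cancels in the quotient. This is why A_{m,4} = A_{m,0} and
  A_{m,10} = A_{m,6} are natural.\<close>

lemma phi_1: "phi 1 \<epsilon> = phi 0 \<epsilon>" if "\<epsilon> \<in> {0, 1}"
  using that by (auto simp: phi_def core_def next4_def shift_def power2_eq_square)

lemma shift_1: "shift 1 \<epsilon> = shift 0 \<epsilon>"
  by (simp add: shift_def)

lemma inj_shift: "inj_on (\<lambda>r. nat (r + shift \<delta> \<epsilon>)) {r. r + shift \<delta> \<epsilon> \<ge> 0}"
  by (rule inj_onI) auto

text \<open>The presentation has A but no degree, the extremal shape has a degree bound but unnamed
  polynomials. Irrationality of \<open>phi\<close> identifies their \<open>E2\<close> parts up to a
  scalar.\<close>

lemma pade_family_base:
  assumes "extremal_family G" and "atkin_like G A B" and "\<delta> \<in> {0, 2}" and "\<epsilon> \<in> {0, 1}"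
  shows "\<exists>b \<kappa>. pade_family (phi \<delta> \<epsilon>) {r. r + shift \<delta> \<epsilon> \<ge> 0} (\<lambda>r. nat (r + shift \<delta> \<epsilon>))
    (\<lambda>r. atkin_ext A r (4 * \<delta> + 6 * \<epsilon>)) b \<kappa> (\<lambda>r. G (wt \<delta> \<epsilon> r) / core \<delta> \<epsilon> r)"
proof -
  have \<delta>: "\<delta> \<in> {0, 1, 2}" using assms(3) by auto
  have "\<exists>b \<kappa>. r + shift \<delta> \<epsilon> \<ge> 0 \<longrightarrow> degree (atkin_ext A r (4 * \<delta> + 6 * \<epsilon>)) \<le> nat (r + shift \<delta> \<epsilon>) \<and>
      G (wt \<delta> \<epsilon> r) / core \<delta> \<epsilon> r = fls_const \<kappa> * (at_j (atkin_ext A r (4 * \<delta> + 6 * \<epsilon>)) * phi \<delta> \<epsilon> + at_j b)" for r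
  proof (cases "r + shift \<delta> \<epsilon> \<ge> 0")
    case True
    from atkin_like_form[OF assms(2-4) True] obtain \<kappa> b where
      ab: "G (wt \<delta> \<epsilon> r) / core \<delta> \<epsilon> r = fls_const \<kappa> * (at_j (atkin_ext A r (4 * \<delta> + 6 * \<epsilon>)) * phi \<delta> \<epsilon> + at_j b)"
      by metis
    from extremal_quotient[OF assms(1) \<delta> assms(4) True] obtain p q where
      pq: "degree p \<le> nat (r + shift \<delta> \<epsilon>)" "G (wt \<delta> \<epsilon> r) / core \<delta> \<epsilon> r = at_j p * phi \<delta> \<epsilon> + at_j q"
        "has_lead (r + shift \<delta> \<epsilon> + 1) (G (wt \<delta> \<epsilon> r) / core \<delta> \<epsilon> r)"
      by metis
    have "\<kappa> \<noteq> 0" using pq(3) unfolding ab by (rule has_lead_scaled_nonzero)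
    have "at_j (smult \<kappa> (atkin_ext A r (4 * \<delta> + 6 * \<epsilon>)) - p) * phi \<delta> \<epsilon> = at_j (q - smult \<kappa> b)"
      using ab unfolding pq(2) by (simp add: algebra_simps)
    from phi_irrational(1)[OF \<delta> assms(4) this] have "p = smult \<kappa> (atkin_ext A r (4 * \<delta> + 6 * \<epsilon>))" by simp
    with pq(1) \<open>\<kappa> \<noteq> 0\<close> ab show ?thesis by auto
  qed simp
  then obtain b \<kappa> where *: "\<And>r. r + shift \<delta> \<epsilon> \<ge> 0 \<Longrightarrow> degree (atkin_ext A r (4 * \<delta> + 6 * \<epsilon>)) \<le> nat (r + shift \<delta> \<epsilon>) \<and>
      G (wt \<delta> \<epsilon> r) / core \<delta> \<epsilon> r = fls_const (\<kappa> r) * (at_j (atkin_ext A r (4 * \<delta> + 6 * \<epsilon>)) * phi \<delta> \<epsilon> + at_j (b r))"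
    by metis
  have "has_lead (r + shift \<delta> \<epsilon> + 1) (G (wt \<delta> \<epsilon> r) / core \<delta> \<epsilon> r)" if "r + shift \<delta> \<epsilon> \<ge> 0" for r
    using extremal_quotient[OF assms(1) \<delta> assms(4) that] by metis
  with * show ?thesis
    by (intro exI[of _ b] exI[of _ \<kappa>] pade_family.intro inj_shift) auto
qed

text \<open>
  The relation \<open>G\<^bsub>w+4\<^esub> = E\<^sub>4 G\<^sub>w\<close> for \<open>6 dvd w\<close>: both sides yield Pade approximants of the same
  series and of the same order.
\<close>

lemma extremal_quotient_1:
  assumes "extremal_family G" and "atkin_like G A B" and "\<epsilon> \<in> {0, 1}" and "r + shift 0 \<epsilon> \<ge> 0"
  shows "G (wt 1 \<epsilon> r) / core 1 \<epsilon> r = G (wt 0 \<epsilon> r) / core 0 \<epsilon> r"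
proof -
  from pade_family_base[OF assms(1,2), of 0 \<epsilon>] assms(3) obtain b \<kappa> where
    "pade_family (phi 0 \<epsilon>) {r. r + shift 0 \<epsilon> \<ge> 0} (\<lambda>r. nat (r + shift 0 \<epsilon>))
      (\<lambda>r. atkin_ext A r (4 * 0 + 6 * \<epsilon>)) b \<kappa> (\<lambda>r. G (wt 0 \<epsilon> r) / core 0 \<epsilon> r)"
    by blast
  then interpret pade_family "phi 0 \<epsilon>" "{r. r + shift 0 \<epsilon> \<ge> 0}" "\<lambda>r. nat (r + shift 0 \<epsilon>)"
      "\<lambda>r. atkin_ext A r (4 * 0 + 6 * \<epsilon>)" b \<kappa> "\<lambda>r. G (wt 0 \<epsilon> r) / core 0 \<epsilon> r" .
  have quotient: "\<exists>p q. degree p \<le> nat (r + shift 0 \<epsilon>) \<and> G (wt \<delta> \<epsilon> r) / core \<delta> \<epsilon> r = at_j p * phi 0 \<epsilon> + at_j q \<and>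
      has_lead (r + shift 0 \<epsilon> + 1) (G (wt \<delta> \<epsilon> r) / core \<delta> \<epsilon> r)" if "\<delta> = 0 \<or> \<delta> = 1" for \<delta>
    using that extremal_quotient[OF assms(1) _ assms(3), of \<delta> r] assms(4)
    by (elim disjE; simp add: shift_1[unfolded One_nat_def] phi_1[OF assms(3), unfolded One_nat_def]) metis+
  from quotient[of 0] quotient[of 1] obtain p q p' q' where
    *: "degree p \<le> nat (r + shift 0 \<epsilon>)" "G (wt 0 \<epsilon> r) / core 0 \<epsilon> r = at_j p * phi 0 \<epsilon> + at_j q"
      "has_lead (r + shift 0 \<epsilon> + 1) (G (wt 0 \<epsilon> r) / core 0 \<epsilon> r)"
      "degree p' \<le> nat (r + shift 0 \<epsilon>)" "G (wt 1 \<epsilon> r) / core 1 \<epsilon> r = at_j p' * phi 0 \<epsilon> + at_j q'"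
      "has_lead (r + shift 0 \<epsilon> + 1) (G (wt 1 \<epsilon> r) / core 1 \<epsilon> r)"
    by auto
  have diff: "at_j (p' - p) * phi 0 \<epsilon> + at_j (q' - q) = G (wt 1 \<epsilon> r) / core 1 \<epsilon> r - G (wt 0 \<epsilon> r) / core 0 \<epsilon> r"
    unfolding *(2,5) by (simp add: algebra_simps)
  have "at_j (p' - p) * phi 0 \<epsilon> + at_j (q' - q) = 0"
  proof (rule pade_unique)
    show "\<exists>i\<in>{r. r + shift 0 \<epsilon> \<ge> 0}. nat (i + shift 0 \<epsilon>) = n" for n
      by (rule bexI[of _ "int n - shift 0 \<epsilon>"]) auto
    show "degree (p' - p) \<le> nat (r + shift 0 \<epsilon>)" using *(1,4) by (intro degree_diff_le)
    \<comment> \<open>Both quotients have leading coefficient 1, so their difference vanishes one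
      order further than either.\<close>
    show "fls_nth (at_j (p' - p) * phi 0 \<epsilon> + at_j (q' - q)) i = 0" if "i \<le> int (nat (r + shift 0 \<epsilon>)) + 1" for i
      unfolding diff using that assms(4) *(3,6) has_lead_below[OF *(3), of i] has_lead_below[OF *(6), of i]
      by (cases "i = r + shift 0 \<epsilon> + 1") (auto simp: has_lead_def)
  qed
  thus ?thesis unfolding diff by simp
qed

lemma atkin_pade_family:
  assumes "extremal_family G" and "atkin_like G A B" and "\<delta> \<in> {0, 1, 2}" and "\<epsilon> \<in> {0, 1}"
  shows "\<exists>b \<kappa>. pade_family (phi \<delta> \<epsilon>) {r. r + shift \<delta> \<epsilon> \<ge> 0} (\<lambda>r. nat (r + shift \<delta> \<epsilon>))
    (\<lambda>r. atkin_ext A r (4 * \<delta> + 6 * \<epsilon>)) b \<kappa> (\<lambda>r. G (wt \<delta> \<epsilon> r) / core \<delta> \<epsilon> r)"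
    and "r + shift \<delta> \<epsilon> \<ge> 0 \<Longrightarrow> lead_coeff (atkin_ext A r (4 * \<delta> + 6 * \<epsilon>)) = 1"
proof -
  have ext_1: "atkin_ext A r (4 * 1 + 6 * \<epsilon>) = atkin_ext A r (4 * 0 + 6 * \<epsilon>)" for r
    using assms(4) by (auto simp: atkin_ext_def)
  show "\<exists>b \<kappa>. pade_family (phi \<delta> \<epsilon>) {r. r + shift \<delta> \<epsilon> \<ge> 0} (\<lambda>r. nat (r + shift \<delta> \<epsilon>))
    (\<lambda>r. atkin_ext A r (4 * \<delta> + 6 * \<epsilon>)) b \<kappa> (\<lambda>r. G (wt \<delta> \<epsilon> r) / core \<delta> \<epsilon> r)"
  proof (cases "\<delta> = 1")
    case True
    from pade_family_base[OF assms(1,2), of 0 \<epsilon>] assms(4) obtain b \<kappa> where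
      "pade_family (phi 0 \<epsilon>) {r. r + shift 0 \<epsilon> \<ge> 0} (\<lambda>r. nat (r + shift 0 \<epsilon>))
        (\<lambda>r. atkin_ext A r (4 * 0 + 6 * \<epsilon>)) b \<kappa> (\<lambda>r. G (wt 0 \<epsilon> r) / core 0 \<epsilon> r)"
      by blast
    note base = this
    have quotient: "G (wt 1 \<epsilon> r) / core 1 \<epsilon> r = G (wt 0 \<epsilon> r) / core 0 \<epsilon> r"
      if "r \<in> {r. r + shift 0 \<epsilon> \<ge> 0}" for r
      using extremal_quotient_1[OF assms(1,2,4)] that by simp
    have "pade_family (phi \<delta> \<epsilon>) {r. r + shift \<delta> \<epsilon> \<ge> 0} (\<lambda>r. nat (r + shift \<delta> \<epsilon>))
      (\<lambda>r. atkin_ext A r (4 * \<delta> + 6 * \<epsilon>)) b \<kappa> (\<lambda>r. G (wt \<delta> \<epsilon> r) / core \<delta> \<epsilon> r)"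
      unfolding True ext_1 shift_1 phi_1[OF assms(4)]
      by (rule pade_family.intro; (simp only: quotient)?;
          rule pade_family.form[OF base] pade_family.lead[OF base]
            pade_family.degree_le[OF base] pade_family.inj[OF base]; assumption)
    thus ?thesis by blast
  qed (use assms pade_family_base[OF assms(1,2), of \<delta> \<epsilon>] in auto)
  show "lead_coeff (atkin_ext A r (4 * \<delta> + 6 * \<epsilon>)) = 1" if "r + shift \<delta> \<epsilon> \<ge> 0"
  proof (cases "\<delta> = 1")
    case True
    show ?thesis
      using atkin_like_form[OF assms(2), of 0 \<epsilon> r] that assms(4) unfolding True ext_1 shift_1 by auto
  qed (use atkin_like_form[OF assms(2), of \<delta> \<epsilon> r] that assms in auto)
qed

text \<open>Stated for any monic sequence \<open>P\<close>, to serve the Faber polynomials of weight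
  k and of weight 2 - k alike.\<close>

lemma expansion_coefficient:
  assumes "extremal_family G" and "atkin_like G A B" and "\<delta> \<in> {0, 1, 2}" and "\<epsilon> \<in> {0, 1}"
    and "l + shift \<delta> \<epsilon> \<ge> 0"
    and "\<And>n. degree (P n) = n" and "\<And>n. lead_coeff (P n) = 1"
    and "\<And>n. P n = (\<Sum>r\<in>atkin_range A (4 * \<delta> + 6 * \<epsilon>) n. smult (c n r) (atkin_ext A r (4 * \<delta> + 6 * \<epsilon>)))"
    and "\<And>n r. r \<notin> atkin_range A (4 * \<delta> + 6 * \<epsilon>) n \<Longrightarrow> c n r = 0"
  shows "c n l = pairing (P n) (G (wt \<delta> \<epsilon> l) / core \<delta> \<epsilon> l)"
proof -
  from atkin_pade_family(1)[OF assms(1-4)] obtain b \<kappa> where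
    "pade_family (phi \<delta> \<epsilon>) {r. r + shift \<delta> \<epsilon> \<ge> 0} (\<lambda>r. nat (r + shift \<delta> \<epsilon>))
      (\<lambda>r. atkin_ext A r (4 * \<delta> + 6 * \<epsilon>)) b \<kappa> (\<lambda>r. G (wt \<delta> \<epsilon> r) / core \<delta> \<epsilon> r)"
    by blast
  from pade_family.coefficient_eq_pairing[OF this, where P = P and c = c and S = "atkin_range A (4 * \<delta> + 6 * \<epsilon>)" and i = l]
  show ?thesis
    using assms(5-9) atkin_pade_family(2)[OF assms(1-4)] depth1_weight_iff[OF assms(3,4)]
    by (auto simp: atkin_range_def add.assoc)
qed

text \<open>The remainder of \<open>f\<close> is O(q^(M+1)) and \<open>h\<close> is O(q^(-M)), so
  only the monomial q^(-L) reaches the constant term.\<close>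

lemma residue_extraction:
  fixes f h :: "complex fls"
  assumes f: "\<And>i. i \<le> M \<Longrightarrow> fls_nth f i = (if i = - L then 1 else 0)" and "- L \<le> M"
    and h: "\<And>i. i < - M \<Longrightarrow> fls_nth h i = 0"
  shows "fls_nth (f * h) 0 = fls_nth h L"
proof -
  define f' where "f' = f - fls_X_intpow (- L)"
  have "fls_nth f' i = 0" if "i < M + 1" for i
    using f[of i] that by (auto simp: f'_def)
  hence "fls_nth (f' * h) 0 = 0"
    using h by (intro fls_mult_order(1)[of "M + 1" f' "- M" h]) auto
  moreover have "f * h = f' * h + fls_X_intpow (- L) * h" by (simp add: f'_def algebra_simps)
  moreover have "fls_nth (fls_X_intpow (- L) * h) 0 = fls_nth h L"
    by (subst fls_X_intpow_times_conv_shift) simp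
  ultimately show ?thesis by (simp only: fls_plus_nth add_0)
qed

lemma generating_function_eqI:
  fixes h :: "complex fls"
  assumes "\<And>n. c n = fls_nth h (int n + a)" and "\<And>i. i < a \<Longrightarrow> fls_nth h i = 0"
  shows "fls_X_intpow a * fps_to_fls (Abs_fps c) = h"
  by (rule fls_eqI) (use assms in \<open>auto simp: fls_X_intpow_times_conv_shift\<close>)

text \<open>Replacing the derivative of j by - E4^2 E6 / \<open>Delta\<close> turns the residue of
  p(j) g dj into the constant term of a product of two forms, one of which has the shape of a Faber
  form.\<close>

lemma pairing_eq_residue:
  assumes "core \<delta>' \<epsilon>' m * h * Delta = g * E4 ^ 2 * E6"
  shows "pairing p g = fls_nth (core \<delta>' \<epsilon>' m * at_j p * h) 0"
proof -
  have "fls_X * (- (at_j p * g * fls_deriv klein_j)) = - (at_j p * g * theta klein_j)"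
    by (simp add: theta_def algebra_simps)
  also have "- (at_j p * g * theta klein_j) * Delta = core \<delta>' \<epsilon>' m * at_j p * h * Delta"
    using theta_klein_j assms by algebra
  hence "- (at_j p * g * theta klein_j) = core \<delta>' \<epsilon>' m * at_j p * h"
    using mult_right_cancel forms_nonzero(4) by blast
  finally have "fls_nth (fls_X * (- (at_j p * g * fls_deriv klein_j))) 0 = fls_nth (core \<delta>' \<epsilon>' m * at_j p * h) 0"
    by simp
  thus ?thesis by (simp add: pairing_def fls_X_times_conv_shift)
qed

lemma mero_quasimodular_mult_powi:
  assumes "f \<in> mero_quasimodular v" and "h \<in> quasimodular u 0" and "h \<noteq> 0"
  shows "f * h powi a \<in> mero_quasimodular (v + a * u)"
proof -
  from assms(1) obtain n d w s z where f: "f = n / d" "n \<in> quasimodular w s" "d \<in> quasimodular z 0" "d \<noteq> 0" "w - z = v"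
    unfolding mero_quasimodular_def by blast
  show ?thesis
  proof (cases "a \<ge> 0")
    case True
    have "f * h powi a = (n * h ^ nat a) / d" using True by (simp add: f(1) power_int_def)
    moreover have "n * h ^ nat a \<in> quasimodular (w + int (nat a) * u) s"
      by (intro quasimodular_mult modular_power f assms)
    moreover have "w + int (nat a) * u - z = v + a * u" using True f(5) by simp
    ultimately show ?thesis unfolding mero_quasimodular_def using f(3,4) by blast
  next
    case False
    have "f * h powi a = n / (d * h ^ nat (- a))"
      using False by (simp add: f(1) power_int_def field_simps)
    moreover have "d * h ^ nat (- a) \<in> quasimodular (z + int (nat (- a)) * u) 0"
      by (intro quasimodular_mult modular_power f assms)
    moreover have "w - (z + int (nat (- a)) * u) = v + a * u" using False f(5) by simp
    moreover have "d * h ^ nat (- a) \<noteq> 0" using f(4) assms(3) by simp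
    ultimately show ?thesis unfolding mero_quasimodular_def using f(2) by blast
  qed
qed

lemma mero_quasimodularI:
  assumes "f \<in> quasimodular w s"
  shows "f \<in> mero_quasimodular w"
proof -
  have "f = f / 1" "w - 0 = w" "(1 :: complex fls) \<noteq> 0" by simp_all
  thus ?thesis unfolding mero_quasimodular_def using assms modular_1 by blast
qed

text \<open>The complementary exponents are those with which the two cores multiply to E4^2 E6 /
  \<open>Delta\<close>, of weight 2.\<close>

lemma weight_decomp_dual:
  assumes "weight_decomp k m \<delta> \<epsilon>"
  shows "weight_decomp (2 - k) (- m - 1) (2 - \<delta>) (1 - \<epsilon>)"
  using assms unfolding weight_decomp_def by auto

section \<open>The two generating functions\<close>

lemma faberD:
  assumes "faber_family F" and "weight_decomp k m \<delta> \<epsilon>"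
  shows "lead_coeff (F k n) = 1" and "degree (F k n) = n"
    and "i \<le> m \<Longrightarrow> fls_nth (core \<delta> \<epsilon> m * at_j (F k n)) i = (if i = - (int n - m) then 1 else 0)"
  using assms unfolding faber_family_def Let_def core_def by blast+

lemma generating_function:
  assumes "extremal_family G" and "atkin_like G A B" and "faber_family F" and "faber_coeffs A F \<omega>"
    and k: "weight_decomp k m \<delta> \<epsilon>" and "depth1_weight (wt \<delta> \<epsilon> l)"
  defines "h \<equiv> E4 powi (2 - 2 * int \<delta>) * E6 powi (1 - 2 * int \<epsilon>) / Delta powi (l + m + 1) * G (wt \<delta> \<epsilon> l)"
  shows "fls_X_intpow (- m) * fps_to_fls (Abs_fps (\<lambda>n. \<omega> k n l)) = h"
proof -
  have de: "\<delta> \<in> {0, 1, 2}" "\<epsilon> \<in> {0, 1}" using k by (auto simp: weight_decomp_def)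
  have l: "l + shift \<delta> \<epsilon> \<ge> 0" using depth1_weight_iff[OF de, of l] assms(6) by (simp add: wt_def)
  define g where "g = G (wt \<delta> \<epsilon> l) / core \<delta> \<epsilon> l"
  have g: "has_lead (l + shift \<delta> \<epsilon> + 1) g"
    using extremal_quotient[OF assms(1) de l] unfolding g_def by metis
  have G: "G (wt \<delta> \<epsilon> l) = g * core \<delta> \<epsilon> l" by (simp add: g_def)
  \<comment> \<open>The factor in \<open>h\<close> is E4^2 E6 / \<open>Delta\<close> divided by the
    cores with exponents m and l.\<close>
  have eq: "core \<delta> \<epsilon> m * h * Delta = g * E4 ^ 2 * E6"
    using de by (auto simp: h_def G core_def power_int_add power_int_minus field_simps eval_nat_numeral)
  have \<omega>: "\<omega> k n l = pairing (F k n) g" for n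
    unfolding g_def
  proof (rule expansion_coefficient[OF assms(1,2) de l faberD(2,1)[OF assms(3) k]])
    show "F k n = (\<Sum>r\<in>atkin_range A (4 * \<delta> + 6 * \<epsilon>) n. smult (\<omega> k n r) (atkin_ext A r (4 * \<delta> + 6 * \<epsilon>)))"
      "r \<notin> atkin_range A (4 * \<delta> + 6 * \<epsilon>) n \<Longrightarrow> \<omega> k n r = 0" for n r
      using assms(4) k unfolding faber_coeffs_def Let_def by blast+
  qed
  have "h = g * E4 ^ 2 * E6 / Delta / core \<delta> \<epsilon> m" using eq by (simp add: field_simps)
  \<comment> \<open>The order is l - m + shift, hence at least - m: just enough for the remainder
    O(q^(m+1)) of the Faber form to leave the constant term alone.\<close>
  moreover have "has_lead (l + shift \<delta> \<epsilon> + 1 + int 2 * 0 + 0 - 1 - m) (g * E4 ^ 2 * E6 / Delta / core \<delta> \<epsilon> m)"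
    by (intro has_lead_divide has_lead_mult has_lead_power g has_lead_E4 has_lead_E6 has_lead_Delta has_lead_core)
  ultimately have h: "i < - m \<Longrightarrow> fls_nth h i = 0" for i
    using l by (auto intro!: has_lead_below)
  show ?thesis
  proof (rule generating_function_eqI)
    fix n
    show "\<omega> k n l = fls_nth h (int n + - m)"
      using residue_extraction[of m "core \<delta> \<epsilon> m * at_j (F k n)" "int n - m" h] faberD(3)[OF assms(3) k, of _ n] h
      by (simp add: \<omega> pairing_eq_residue[OF eq])
  qed (use h in auto)
qed

lemma dual_generating_function:
  assumes "extremal_family G" and "atkin_like G A B" and "faber_family F" and "dual_faber_coeffs A F \<Omega>"
    and k: "weight_decomp k m \<delta> \<epsilon>" and "depth1_weight (wt \<delta> \<epsilon> l)"
  defines "h \<equiv> Delta powi (m - l) * G (wt \<delta> \<epsilon> l)"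
  shows "fls_X_intpow (m + 1) * fps_to_fls (Abs_fps (\<lambda>n. \<Omega> (2 - k) n l)) = h"
proof -
  have de: "\<delta> \<in> {0, 1, 2}" "\<epsilon> \<in> {0, 1}" using k by (auto simp: weight_decomp_def)
  have l: "l + shift \<delta> \<epsilon> \<ge> 0" using depth1_weight_iff[OF de, of l] assms(6) by (simp add: wt_def)
  note k' = weight_decomp_dual[OF k]
  define g where "g = G (wt \<delta> \<epsilon> l) / core \<delta> \<epsilon> l"
  have g: "has_lead (l + shift \<delta> \<epsilon> + 1) g"
    using extremal_quotient[OF assms(1) de l] unfolding g_def by metis
  have h_eq: "h = Delta powi (m - l) * (g * core \<delta> \<epsilon> l)" by (simp add: h_def g_def)
  have "- m - 1 + (m - l) + l + 1 = 0" by simp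
  hence Delta: "Delta powi (- m - 1) * Delta powi (m - l) * Delta powi l * Delta = 1"
    by (metis forms_nonzero(4) power_int_0_right power_int_add power_int_add_1)
  have "core (2 - \<delta>) (1 - \<epsilon>) (- m - 1) * h * Delta =
      E4 ^ (2 - \<delta>) * E4 ^ \<delta> * (E6 ^ (1 - \<epsilon>) * E6 ^ \<epsilon>) * g *
      (Delta powi (- m - 1) * Delta powi (m - l) * Delta powi l * Delta)"
    by (simp only: h_eq core_def ac_simps)
  also have "\<dots> = g * E4 ^ 2 * E6"
    unfolding Delta power_add[symmetric] using de by (auto simp: power2_eq_square)
  finally have eq: "core (2 - \<delta>) (1 - \<epsilon>) (- m - 1) * h * Delta = g * E4 ^ 2 * E6" .
  have \<Omega>: "\<Omega> (2 - k) n l = pairing (F (2 - k) n) g" for n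
    unfolding g_def
  proof (rule expansion_coefficient[OF assms(1,2) de l faberD(2,1)[OF assms(3) k']])
    show "F (2 - k) n = (\<Sum>r\<in>atkin_range A (4 * \<delta> + 6 * \<epsilon>) n. smult (\<Omega> (2 - k) n r) (atkin_ext A r (4 * \<delta> + 6 * \<epsilon>)))"
      "r \<notin> atkin_range A (4 * \<delta> + 6 * \<epsilon>) n \<Longrightarrow> \<Omega> (2 - k) n r = 0" for n r
      using assms(4) k unfolding dual_faber_coeffs_def Let_def by blast+
  qed
  \<comment> \<open>The order m + l + shift + 1 is at least m + 1, matching the remainder O(q^(-m))
    of the Faber form of weight 2 - k.\<close>
  have "has_lead ((m - l) * 1 + (l + shift \<delta> \<epsilon> + 1 + l)) h"
    unfolding h_eq by (intro has_lead_mult has_lead_powi has_lead_Delta g has_lead_core)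
  hence h: "i < m + 1 \<Longrightarrow> fls_nth h i = 0" for i
    using l by (auto intro!: has_lead_below)
  show ?thesis
  proof (rule generating_function_eqI)
    fix n
    show "\<Omega> (2 - k) n l = fls_nth h (int n + (m + 1))"
      using residue_extraction[of "- m - 1" "core (2 - \<delta>) (1 - \<epsilon>) (- m - 1) * at_j (F (2 - k) n)" "int n - (- m - 1)" h]
        faberD(3)[OF assms(3) k', of _ n] h
      by (simp add: \<Omega> pairing_eq_residue[OF eq] algebra_simps)
  qed (use h in auto)
qed

theorem theorem4p3:
  fixes G :: "int \<Rightarrow> complex fls"
    and A B F :: "int \<Rightarrow> nat \<Rightarrow> complex poly"
    and \<omega> \<Omega> :: "int \<Rightarrow> nat \<Rightarrow> int \<Rightarrow> complex"
    and k m l w :: int and \<delta> \<epsilon> :: nat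
  assumes "extremal_family G"
    and "atkin_like G A B"
    and "faber_family F"
    and "faber_coeffs A F \<omega>"
    and "dual_faber_coeffs A F \<Omega>"
    and "weight_decomp k m \<delta> \<epsilon>"
    and "w = 12 * l + 4 * int \<delta> + 6 * int \<epsilon>"
    and "w \<in> {u. even u \<and> u \<ge> 2} - {4}"
  shows "fls_X_intpow (- m) * fps_to_fls (Abs_fps (\<lambda>n. \<omega> k n l)) =
           E4 powi (2 - 2 * int \<delta>) * E6 powi (1 - 2 * int \<epsilon>) / Delta powi (l + m + 1) * G w \<and>
         E4 powi (2 - 2 * int \<delta>) * E6 powi (1 - 2 * int \<epsilon>) / Delta powi (l + m + 1) * G w
           \<in> mero_quasimodular (2 - k) \<and>
         fls_X_intpow (m + 1) * fps_to_fls (Abs_fps (\<lambda>n. \<Omega> (2 - k) n l)) =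
           Delta powi (m - l) * G w \<and>
         Delta powi (m - l) * G w \<in> mero_quasimodular k \<and>
         G w = fls_X_intpow (l + 1) * fps_to_fls (Abs_fps (\<lambda>n. \<Omega> (2 - w) n l))"
proof -
  have w: "w = wt \<delta> \<epsilon> l" using assms(7) by (simp add: wt_def)
  have depth1: "depth1_weight w" using assms(8) by (auto simp: depth1_weight_def)
  have k: "k = 12 * m + 4 * int \<delta> + 6 * int \<epsilon>" "weight_decomp w l \<delta> \<epsilon>"
    using assms(6,7) by (auto simp: weight_decomp_def)
  have "G w \<in> quasimodular w 1"
    using assms(1) depth1 by (simp only: extremal_family_def normalized_extremal_def)
  hence Gw: "G w \<in> mero_quasimodular w" by (rule mero_quasimodularI)
  have "G w * Delta powi (m - l) \<in> mero_quasimodular (w + (m - l) * 12)"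
    by (intro mero_quasimodular_mult_powi Gw modular_Delta forms_nonzero)
  moreover have "w + (m - l) * 12 = k" using assms(7) k(1) by simp
  ultimately have mero_k: "Delta powi (m - l) * G w \<in> mero_quasimodular k" by (simp add: mult.commute)
  have "G w * E4 powi (2 - 2 * int \<delta>) * E6 powi (1 - 2 * int \<epsilon>) * Delta powi (- (l + m + 1))
      \<in> mero_quasimodular (w + (2 - 2 * int \<delta>) * 4 + (1 - 2 * int \<epsilon>) * 6 + (- (l + m + 1)) * 12)"
    by (intro mero_quasimodular_mult_powi Gw modular_E4 modular_E6 modular_Delta forms_nonzero)
  moreover have "w + (2 - 2 * int \<delta>) * 4 + (1 - 2 * int \<epsilon>) * 6 + (- (l + m + 1)) * 12 = 2 - k"
    using assms(7) k(1) by simp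
  moreover have "G w * E4 powi (2 - 2 * int \<delta>) * E6 powi (1 - 2 * int \<epsilon>) * Delta powi (- (l + m + 1)) =
      E4 powi (2 - 2 * int \<delta>) * E6 powi (1 - 2 * int \<epsilon>) / Delta powi (l + m + 1) * G w"
    unfolding power_int_minus by (simp only: field_class.field_divide_inverse ac_simps)
  ultimately have mero_2k: "E4 powi (2 - 2 * int \<delta>) * E6 powi (1 - 2 * int \<epsilon>) / Delta powi (l + m + 1) * G w
      \<in> mero_quasimodular (2 - k)"
    by (simp only:)
  \<comment> \<open>The case k = w and m = l, where the power of \<open>Delta\<close> is 0.\<close>
  have "G w = fls_X_intpow (l + 1) * fps_to_fls (Abs_fps (\<lambda>n. \<Omega> (2 - w) n l))"
    using dual_generating_function[OF assms(1,2,3,5) k(2) depth1[unfolded w]] by (simp add: w)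
  thus ?thesis
    using mero_k mero_2k generating_function[OF assms(1-4,6) depth1[unfolded w]]
      dual_generating_function[OF assms(1,2,3,5,6) depth1[unfolded w]]
    unfolding w by blast
qed

end
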